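(* For any $p\in(0,1)$, there exists a probability measure $\mu$ on $\mathbb{N}=\{0,1,2,\dots\}$ with full support such that, with respect to the birth-death Dirichlet form $\mathcal{E}(f,g)=\sum_{k\ge 0}(f(k+1)-f(k))(g(k+1)-g(k))\mu(\{k\})$, the measure $\mu$ does not satisfy the $p$-log-Sobolev inequality (with any finite constant) but satisfies the $q$-log-Sobolev inequality (with some finite constant, which may depend on $q$) for all $q\in(0,p)$. In particular, there is no interval $I\subset(0,1]$ with non-empty interior for which there exists a constant $c(I)>0$ depending only on $I$ such that for all $p,q\in I$, all $C>0$ and every pair $(\mu,\mathcal{E})$ (a fully supported probability measure on a discrete space together with the Dirichlet form of a reversible Markov semigroup), $p$-LS$(C)$ for $(\mu,\mathcal{E})$ implies $q$-LS$(c(I)\,C)$ for $(\mu,\mathcal{E})$.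
   Context: General setting. Let $(\Omega,\mathcal{B},\mu)$ be a discrete probability space with $\mu$ fully supported on $\Omega$, and let $P\colon[0,\infty)\times\Omega\times\mathcal{B}\to[0,1]$ be a homogeneous Markov transition function for which $\mu$ is invariant, which is reversible with respect to $\mu$ and which induces a strongly continuous semigroup $P_tf(x)=\int_\Omega f(y)P(t,x,dy)$ on $L_2(\Omega,\mu)$. Its Dirichlet form is $$\mathcal{E}(f,g)=\lim_{t\to0^+}\frac1{2t}\int_\Omega\int_\Omega(f(x)-f(y))(g(x)-g(y))P(t,x,dy)\mu(dx)$$ for $f,g\in\mathcal{H}$, where $\mathcal{H}=\{f\in L_2(\Omega,\mu):\sup_{t>0}\frac1{2t}\int\int(f(x)-f(y))^2P(t,x,dy)\mu(dx)<\infty\}$. Birth-death setting. For a fully supported probability measure $\mu$ on $\mathbb{N}$, write $\mu_k=\mu(\{k\})$ and $Df(k)=f(k+1)-f(k)$; the associated Dirichlet form is $\mathcal{E}(f,g)=\sum_{k\ge0}Df(k)Dg(k)\mu_k$ with domain $\mathcal{H}=\{h\in L_2(\mathbb{N},\mu):\sum_{k\ge0}(Dh(k))^2\mu_k<\infty\}$. In both settings let $\mathcal{H}_+$ be the set of $f\in\mathcal{H}$ with values in $(0,\infty)$, and $\mathrm{Ent}_\mu(f)=\int f\log f\,d\mu-\int f\,d\mu\,\log\int f\,d\mu$. For $p\in(0,1)$, $p$-LS$(C)$ (the $p$-log-Sobolev inequality with constant $C>0$) is $$\mathrm{Ent}_\mu(f^p)\le\frac{Cp^2}{4(p-1)}\mathcal{E}(f^{p-1},f)\quad\text{for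 all } f\in\mathcal{H}_+\text{ with } f^{p-1}\in\mathcal{H}_+;$$ $1$-LS$(C)$ is $\mathrm{Ent}_\mu(f)\le\frac C4\mathcal{E}(f,\log f)$ for all $f\in\mathcal{H}_+$ with $\log f\in\mathcal{H}$. The measure $\mu$ (or the pair $(\mu,\mathcal{E})$) satisfies the $p$-log-Sobolev inequality if $p$-LS$(C)$ holds for some finite $C>0$. *)

theory Defs
  imports "HOL-Probability.Probability"
begin

text \<open>
  The state space is \<open>space M\<close>; only the values of functions on \<open>space M\<close> matter.
  A fully supported probability measure makes every discrete space countable, so spaces
  carried by subsets of \<open>nat\<close> already represent all of them up to isomorphism.
\<close>

locale discrete_prob_space = prob_space M for M :: "'a measure" +
  assumes sets_eq_Pow: "sets M = Pow (space M)"
    and full_support: "x \<in> space M \<Longrightarrow> 0 < measure M {x}"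

definition L2 :: "'a measure \<Rightarrow> ('a \<Rightarrow> real) set" where
  "L2 M = {f. f \<in> borel_measurable M \<and> integrable M (\<lambda>x. (f x)\<^sup>2)}"

definition semigroup_op :: "(real \<Rightarrow> 'a \<Rightarrow> 'a measure) \<Rightarrow> real \<Rightarrow> ('a \<Rightarrow> real) \<Rightarrow> 'a \<Rightarrow> real" where
  "semigroup_op P t f x = (\<integral>y. f y \<partial>(P t x))"

text \<open>
  \<open>P t x\<close> is the measure \<open>P(t, x, \<cdot>)\<close>; only times \<open>t \<ge> 0\<close> are constrained.  By Jensen's
  inequality and invariance the operators \<open>semigroup_op P t\<close> are contractions of \<open>L2 M\<close>,
  so the integral expressing strong continuity is that of an integrable function.
\<close>

locale reversible_markov = discrete_prob_space M for M :: "'a measure" +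
  fixes P :: "real \<Rightarrow> 'a \<Rightarrow> 'a measure"
  assumes kernel: "0 \<le> t \<Longrightarrow> P t \<in> M \<rightarrow>\<^sub>M prob_algebra M"
    and initial: "x \<in> space M \<Longrightarrow> P 0 x = return M x"
    and chapman_kolmogorov:
      "0 \<le> s \<Longrightarrow> 0 \<le> t \<Longrightarrow> x \<in> space M \<Longrightarrow> A \<in> sets M \<Longrightarrow>
        measure (P (s + t) x) A = (\<integral>y. measure (P t y) A \<partial>(P s x))"
    and invariant:
      "0 \<le> t \<Longrightarrow> A \<in> sets M \<Longrightarrow> (\<integral>x. measure (P t x) A \<partial>M) = measure M A"
    and reversible:
      "0 \<le> t \<Longrightarrow> A \<in> sets M \<Longrightarrow> B \<in> sets M \<Longrightarrow>
        (LINT x:A|M. measure (P t x) B) = (LINT x:B|M. measure (P t x) A)"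
    and strongly_continuous:
      "f \<in> L2 M \<Longrightarrow> ((\<lambda>t. \<integral>x. (semigroup_op P t f x - f x)\<^sup>2 \<partial>M) \<longlongrightarrow> 0) (at_right 0)"

text \<open>All integrals below exist for \<open>f\<close> and \<open>g\<close> in \<open>L2 M\<close>, by invariance and full support.\<close>

definition dirichlet_approx ::
    "'a measure \<Rightarrow> (real \<Rightarrow> 'a \<Rightarrow> 'a measure) \<Rightarrow> real \<Rightarrow> ('a \<Rightarrow> real) \<Rightarrow> ('a \<Rightarrow> real) \<Rightarrow> real" where
  "dirichlet_approx M P t f g =
     1 / (2 * t) * (\<integral>x. (\<integral>y. (f x - f y) * (g x - g y) \<partial>(P t x)) \<partial>M)"

definition markov_form ::
    "'a measure \<Rightarrow> (real \<Rightarrow> 'a \<Rightarrow> 'a measure) \<Rightarrow> ('a \<Rightarrow> real) \<Rightarrow> ('a \<Rightarrow> real) \<Rightarrow> real" where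
  "markov_form M P f g = Lim (at_right 0) (\<lambda>t. dirichlet_approx M P t f g)"

definition markov_domain ::
    "'a measure \<Rightarrow> (real \<Rightarrow> 'a \<Rightarrow> 'a measure) \<Rightarrow> ('a \<Rightarrow> real) set" where
  "markov_domain M P =
     {f \<in> L2 M. bdd_above ((\<lambda>t. dirichlet_approx M P t f f) ` {0<..})}"

definition birth_death_form :: "nat measure \<Rightarrow> (nat \<Rightarrow> real) \<Rightarrow> (nat \<Rightarrow> real) \<Rightarrow> real" where
  "birth_death_form M f g =
     (\<Sum>k. (f (k + 1) - f k) * (g (k + 1) - g k) * measure M {k})"

definition birth_death_domain :: "nat measure \<Rightarrow> (nat \<Rightarrow> real) set" where
  "birth_death_domain M =
     {h \<in> L2 M. summable (\<lambda>k. (h (k + 1) - h k)\<^sup>2 * measure M {k})}"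

definition Ent :: "'a measure \<Rightarrow> ('a \<Rightarrow> real) \<Rightarrow> real" where
  "Ent M f = (\<integral>x. f x * ln (f x) \<partial>M) - (\<integral>x. f x \<partial>M) * ln (\<integral>x. f x \<partial>M)"

definition positive_members :: "'a measure \<Rightarrow> ('a \<Rightarrow> real) set \<Rightarrow> ('a \<Rightarrow> real) set" where
  "positive_members M H = {f \<in> H. \<forall>x\<in>space M. 0 < f x}"

text \<open>
  The inequality \<open>p\<close>-LS\<open>(C)\<close> for the form \<open>E\<close> with domain \<open>H\<close>, meaningful for
  \<open>0 < p \<le> 1\<close> and \<open>C > 0\<close>.  The entropies involved are finite because \<open>H \<subseteq> L2 M\<close>.
\<close>

definition log_sobolev ::
    "'a measure \<Rightarrow> (('a \<Rightarrow> real) \<Rightarrow> ('a \<Rightarrow> real) \<Rightarrow> real) \<Rightarrow> ('a \<Rightarrow> real) set \<Rightarrow> real \<Rightarrow> real \<Rightarrow> bool" where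
  "log_sobolev M E H p C \<longleftrightarrow>
     (if p = 1 then
        \<forall>f \<in> positive_members M H. (\<lambda>x. ln (f x)) \<in> H \<longrightarrow>
          Ent M f \<le> C / 4 * E f (\<lambda>x. ln (f x))
      else
        \<forall>f \<in> positive_members M H. (\<lambda>x. f x powr (p - 1)) \<in> positive_members M H \<longrightarrow>
          Ent M (\<lambda>x. f x powr p) \<le> C * p\<^sup>2 / (4 * (p - 1)) * E (\<lambda>x. f x powr (p - 1)) f)"

abbreviation birth_death_LS :: "nat measure \<Rightarrow> real \<Rightarrow> real \<Rightarrow> bool" where
  "birth_death_LS M \<equiv> log_sobolev M (birth_death_form M) (birth_death_domain M)"

abbreviation markov_LS ::
    "'a measure \<Rightarrow> (real \<Rightarrow> 'a \<Rightarrow> 'a measure) \<Rightarrow> real \<Rightarrow> real \<Rightarrow> bool" where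
  "markov_LS M P \<equiv> log_sobolev M (markov_form M P) (markov_domain M P)"

end

theory Submission
  imports Defs
begin

text \<open>
  Take \<open>\<mu>({k})\<close> proportional to \<open>100 ^ (- k) * (k!) powr (- p)\<close>, so that the ratios
  \<open>\<rho> k = \<mu>({k + 1}) / \<mu>({k})\<close> are of order \<open>(k + 1) powr (- p)\<close>.  If \<open>f powr q\<close> is of order
  \<open>1 / \<mu>({k})\<close>, then the bond from \<open>k\<close> to \<open>k + 1\<close> contributes \<open>\<rho> k powr (- 1 / q) \<approx> k powr (p / q)\<close>
  to the energy, while the point \<open>k\<close> contributes \<open>ln (1 / \<mu>({k})) \<approx> k * ln k\<close> to the entropy.  The
  energy loses exactly when \<open>q \<ge> p\<close>, which refutes the \<open>p\<close>-inequality.  For \<open>q < p\<close> and \<open>f powr q\<close> of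
  mean one, \<open>f powr q \<le> 1 / \<mu>({k})\<close> holds automatically, and a one-step estimate (lemma
  \<open>phi_step\<close>), summed over \<open>k\<close>, bounds the entropy by the energy and the contribution of \<open>k = 0\<close>,
  which is controlled by a Poincare inequality.

  All estimates are uniform over the restrictions of \<open>\<mu>\<close> to \<open>{..n}\<close>.  On these finite sets the
  birth-death form is the form of a genuine Markov semigroup, so the second part only needs finite
  chains: their \<open>q\<close>-constants stay bounded while their \<open>p\<close>-constants do not.
\<close>

section \<open>Estimates for one bond\<close>

text \<open>For values of mean one the entropy is the weighted sum of \<open>phi\<close>. Unlike
  \<open>x * ln x\<close>, it is nonnegative and vanishes to second order at 1, so it can be
  estimated point by point.\<close>

definition phi :: "real \<Rightarrow> real" where
  "phi x = x * ln x - x + 1"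

text \<open>The share of one bond in minus the form of \<open>f powr (q - 1)\<close> and
  \<open>f\<close>. For \<open>q < 1\<close> the power \<open>q - 1\<close> is decreasing, so this
  choice of sign makes it nonnegative.\<close>

definition bd_energy :: "real \<Rightarrow> real \<Rightarrow> real \<Rightarrow> real" where
  "bd_energy q a b = (b - a) * (a powr (q - 1) - b powr (q - 1))"

text \<open>With \<open>s = sqrt x\<close> the difference of the two sides is
  \<open>2 * s * phi s\<close>, and \<open>phi s\<close> is nonnegative because
  \<open>ln s >= 1 - 1 / s\<close>.\<close>

lemma hellinger_le_phi:
  assumes "0 < x" shows "(sqrt x - 1)\<^sup>2 \<le> phi x"
proof -
  define s where "s = sqrt x"
  have s: "0 < s" "x = s\<^sup>2" using assms by (auto simp: s_def)
  have "ln (1 / s) \<le> 1 / s - 1" using s by (intro ln_le_minus_one) auto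
  then have "1 - 1 / s \<le> ln s" using s by (simp add: ln_div)
  then have "s * (1 - 1 / s) \<le> s * ln s" using s by (intro mult_left_mono) auto
  then have "0 \<le> s * ln s - s + 1" using s by (simp add: algebra_simps)
  then have "0 \<le> 2 * s * (s * ln s - s + 1)" using s by simp
  moreover have "ln (s\<^sup>2) = 2 * ln s" using s by (simp add: ln_realpow)
  moreover have "2 * s * (s * ln s - s + 1) = s\<^sup>2 * (2 * ln s) - s\<^sup>2 + 1 - (s - 1)\<^sup>2"
    by algebra
  ultimately have "(s - 1)\<^sup>2 \<le> phi (s\<^sup>2)"
    by (simp add: phi_def)
  then show ?thesis unfolding s(2)[symmetric] unfolding s_def .
qed

lemma square_add_le: "(x + y)\<^sup>2 \<le> 2 * x\<^sup>2 + 2 * y\<^sup>2" for x y :: real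
  using sum_squares_bound[of x y] by (simp add: power2_sum)

lemma phi_nonneg: "0 < x \<Longrightarrow> 0 \<le> phi x"
  using hellinger_le_phi[of x] by (meson order_trans zero_le_power2)

lemma phi_le_square:
  assumes "0 < x" shows "phi x \<le> (x - 1)\<^sup>2"
proof -
  have "x * ln x \<le> x * (x - 1)" using assms ln_le_minus_one by (intro mult_left_mono) auto
  then show ?thesis by (simp add: phi_def power2_eq_square algebra_simps)
qed

text \<open>The converse of \<open>hellinger_le_phi\<close> for bounded \<open>x\<close>: factor
  \<open>x - 1 = (sqrt x + 1) * (sqrt x - 1)\<close>, where the first factor is at most 5.\<close>

lemma phi_le_hellinger:
  assumes "0 < x" "x \<le> 16" shows "phi x \<le> 25 * (sqrt x - 1)\<^sup>2"
proof -
  have "sqrt x \<le> sqrt 16" using assms by (intro real_sqrt_le_mono)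
  then have "sqrt x \<le> 4" by simp
  then have "(sqrt x + 1)\<^sup>2 \<le> 5\<^sup>2" using assms by (intro power_mono) auto
  moreover have "(x - 1)\<^sup>2 = (sqrt x + 1)\<^sup>2 * (sqrt x - 1)\<^sup>2"
    using assms by (simp add: algebra_simps flip: power_mult_distrib)
  ultimately have "(x - 1)\<^sup>2 \<le> 25 * (sqrt x - 1)\<^sup>2"
    by (simp add: mult_right_mono)
  with phi_le_square[OF assms(1)] show ?thesis by linarith
qed

lemma bd_energy_sym: "bd_energy q a b = bd_energy q b a"
  by (simp add: bd_energy_def algebra_simps)

text \<open>A form of the Stroock--Varopoulos inequality.\<close>

lemma powr_half_diff_le_bd_energy:
  assumes "0 < q" "q < 1" "0 < a" "0 < b"
  shows "(sqrt (b powr q) - sqrt (a powr q))\<^sup>2 \<le> bd_energy q a b / (1 - q)"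
proof -
  \<comment> \<open>Both sides are symmetric in \<open>a\<close> and \<open>b\<close> and
    homogeneous of degree \<open>q\<close>, so everything reduces to the ratio
    \<open>t = b / a >= 1\<close>.\<close>
  have *: "(sqrt (b powr q) - sqrt (a powr q))\<^sup>2 \<le> bd_energy q a b / (1 - q)"
    if "0 < a" "a \<le> b" for a b
  proof -
    define t where "t = b / a"
    have t: "1 \<le> t" "b = t * a" using that by (auto simp: t_def)
    \<comment> \<open>Weighted AM-GM bounds \<open>t powr (q - 1)\<close> by
      \<open>q + (1 - q) / t\<close>. This extracts the factor \<open>1 - q\<close> and leaves an
      inequality free of \<open>q\<close>.\<close>
    have "1 powr q * (1 / t) powr (1 - q) \<le> q * 1 + (1 - q) * (1 / t)"
      by (rule Youngs_inequality_0) (use assms t in auto)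
    moreover have "(1 / t) powr (1 - q) = t powr (q - 1)"
      using t powr_minus_divide[of t "1 - q"] by (simp add: powr_divide)
    ultimately have "(1 - q) * (1 - 1 / t) \<le> 1 - t powr (q - 1)"
      by (simp add: algebra_simps)
    then have "(t - 1) * ((1 - q) * (1 - 1 / t)) \<le> (t - 1) * (1 - t powr (q - 1))"
      using t by (intro mult_left_mono) auto
    moreover have "(sqrt t - 1)\<^sup>2 \<le> (t - 1) * (1 - 1 / t)"
    proof -
      have st: "1 \<le> sqrt t" "sqrt t * sqrt t = t" using t by auto
      have "(t - 1) * (1 - 1 / t) = (t - 1)\<^sup>2 / t"
        using t by (simp add: field_simps power2_eq_square)
      also have "(t - 1)\<^sup>2 = (sqrt t - 1)\<^sup>2 * (sqrt t + 1)\<^sup>2"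
        using st by (simp add: algebra_simps flip: power_mult_distrib)
      finally have "(t - 1) * (1 - 1 / t) = (sqrt t - 1)\<^sup>2 * (sqrt t + 1)\<^sup>2 / t" .
      moreover have "t \<le> (sqrt t + 1)\<^sup>2"
        using st by (simp add: power2_eq_square algebra_simps)
      then have "(sqrt t - 1)\<^sup>2 * t / t \<le> (sqrt t - 1)\<^sup>2 * (sqrt t + 1)\<^sup>2 / t"
        using t by (intro divide_right_mono mult_left_mono) auto
      ultimately show ?thesis using t by simp
    qed
    moreover have "(t powr (q / 2) - 1)\<^sup>2 \<le> (sqrt t - 1)\<^sup>2"
    proof (rule power_mono)
      have "t powr (q / 2) \<le> t powr (1 / 2)" using t assms by (intro powr_mono) auto
      then show "t powr (q / 2) - 1 \<le> sqrt t - 1" using t by (simp add: powr_half_sqrt)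
      show "0 \<le> t powr (q / 2) - 1" using t assms by (simp add: ge_one_powr_ge_zero)
    qed
    ultimately have main: "(1 - q) * (t powr (q / 2) - 1)\<^sup>2 \<le> (t - 1) * (1 - t powr (q - 1))"
      using assms by (smt (verit) mult.left_commute mult_left_mono)
    have sq: "sqrt (y powr q) = y powr (q / 2)" if "0 < y" for y
      using that by (simp add: powr_powr flip: powr_half_sqrt)
    have "sqrt (b powr q) = t powr (q/2) * a powr (q/2)"
      using sq[of b] t that by (simp add: powr_mult)
    then have "(sqrt (b powr q) - sqrt (a powr q))\<^sup>2 = (a powr (q/2) * (t powr (q/2) - 1))\<^sup>2"
      using sq[of a] that by (simp add: algebra_simps)
    also have "\<dots> = a powr q * (t powr (q/2) - 1)\<^sup>2"
      using that by (simp add: power_mult_distrib power2_eq_square flip: powr_add)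
    also have "\<dots> \<le> a powr q * ((t - 1) * (1 - t powr (q - 1)) / (1 - q))"
      using main assms by (intro mult_left_mono) (auto simp: field_simps)
    also have "\<dots> = bd_energy q a b / (1 - q)"
    proof -
      have "a powr q = a * a powr (q - 1)" using that by (simp add: powr_mult_base)
      then show ?thesis using t that by (simp add: bd_energy_def powr_mult algebra_simps)
    qed
    finally show ?thesis .
  qed
  show ?thesis
  proof (cases "a \<le> b")
    case True with * assms show ?thesis by simp
  next
    case False
    with *[of b a] assms show ?thesis by (simp add: bd_energy_sym power2_commute)
  qed
qed

lemma bd_energy_nonneg:
  assumes "0 < q" "q < 1" "0 < a" "0 < b"
  shows "0 \<le> bd_energy q a b"
proof -
  have "0 \<le> bd_energy q a b / (1 - q)"
    using powr_half_diff_le_bd_energy[OF assms] by (meson order_trans zero_le_power2)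
  then show ?thesis using assms by (simp add: zero_le_divide_iff)
qed

text \<open>An upward jump of \<open>f\<^sup>q\<close> by a factor \<open>R\<close> costs an extra factor \<open>R\<^sup>\<beta>\<close> in energy,
  \<open>\<beta> = (1 - q) / q\<close>.\<close>

lemma bd_energy_jump:
  assumes "0 < q" "q < 1" "0 < a" "0 < b" and jump: "4 * a powr q \<le> b powr q"
  shows "(1 - 4 powr (q - 1)) / 2 * (b powr q * (b powr q / a powr q) powr ((1 - q) / q))
    \<le> bd_energy q a b"
proof -
  \<comment> \<open>The jump of \<open>f powr q\<close> passes to \<open>f\<close> itself, because
    taking the power \<open>1 / q >= 1\<close> does not shrink a number above 1.\<close>
  have "4 \<le> (b / a) powr q" using assms by (simp add: powr_divide field_simps)
  then have "4 powr (1 / q) \<le> ((b / a) powr q) powr (1 / q)"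
    using assms by (intro powr_mono2) auto
  moreover have "(4::real) powr 1 \<le> 4 powr (1 / q)" using assms by (intro powr_mono) auto
  ultimately have r: "4 \<le> b / a" using assms by (simp add: powr_powr)
  then have ab: "4 * a \<le> b" using assms by (simp add: field_simps)
  have "(b / a) powr (q - 1) \<le> 4 powr (q - 1)" using r assms by (intro powr_mono2') auto
  then have "b powr (q - 1) \<le> 4 powr (q - 1) * a powr (q - 1)"
    using assms by (simp add: powr_divide field_simps)
  then have A: "(1 - 4 powr (q - 1)) * a powr (q - 1) \<le> a powr (q - 1) - b powr (q - 1)"
    by (simp add: algebra_simps)
  have c: "4 powr (q - 1) < (1::real)" using assms by (simp add: powr_less_one)
  \<comment> \<open>Up to the constant, the left side is \<open>b * a powr (q - 1)\<close>, the
    leading product in the energy: there \<open>b - a >= b / 2\<close>, and the second factor loses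
    at most the fraction \<open>4 powr (q - 1)\<close>.\<close>
  have "(b powr q / a powr q) powr ((1 - q) / q) = (b / a) powr (1 - q)"
    using assms by (simp add: powr_divide powr_powr)
  also have "(b / a) powr (1 - q) = b powr (1 - q) * a powr (q - 1)"
    using assms powr_minus_divide[of a "1 - q"] by (simp add: powr_divide)
  finally have "(b powr q / a powr q) powr ((1 - q) / q) = b powr (1 - q) * a powr (q - 1)" .
  moreover have "b powr q * b powr (1 - q) = b"
    using assms by (simp flip: powr_add)
  ultimately have "b powr q * (b powr q / a powr q) powr ((1 - q) / q) = b * a powr (q - 1)"
    by (metis mult.assoc)
  then have "(1 - 4 powr (q - 1)) / 2 * (b powr q * (b powr q / a powr q) powr ((1 - q) / q))
      = b / 2 * ((1 - 4 powr (q - 1)) * a powr (q - 1))" by simp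
  also have "\<dots> \<le> (b - a) * (a powr (q - 1) - b powr (q - 1))"
    using A ab assms c by (intro mult_mono) auto
  finally show ?thesis by (simp add: bd_energy_def)
qed


lemma ln4_ge: "4 / 3 \<le> ln (4::real)"
proof -
  have "ln (4::real) = ln (2 ^ 2)" by simp
  also have "\<dots> = 2 * ln 2" by (subst ln_realpow) auto
  finally show ?thesis using ln2_ge_two_thirds by simp
qed

text \<open>The factor 2 allows absorption when the estimate is summed along the chain. Only a large
  upward jump prevents a bound by \<open>phi (a powr q)\<close> and the Hellinger difference, and
  then the energy is large by \<open>bd_energy_jump\<close>. The logarithmic hypothesis handles the
  part of \<open>ln (b powr q)\<close> inherited from \<open>a\<close>.\<close>

lemma phi_step:
  fixes q D :: real
  assumes q: "0 < q" "q < 1" and D: "0 \<le> D"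
  shows "\<exists>C>0. \<forall>\<rho> a b. 0 < \<rho> \<longrightarrow> \<rho> \<le> 1 / 100 \<longrightarrow> 0 < a \<longrightarrow> 0 < b \<longrightarrow>
    ln (a powr q) \<le> D * \<rho> powr (- 1 / q) \<longrightarrow>
    2 * \<rho> * phi (b powr q) \<le> phi (a powr q) + C * bd_energy q a b"
proof -
  define \<beta> where "\<beta> = (1 - q) / q"
  define c where "c = (1 - 4 powr (q - 1)) / (2::real)"
  \<comment> \<open>The first summand pays for the logarithm of the jump, the second for moderate
    \<open>ln x\<close>, the third for large \<open>ln x\<close> combined with a large jump.\<close>
  define C1 where "C1 = 2 / \<beta> + 6 + 2 * D * 8 powr \<beta>"
  have \<beta>: "0 < \<beta>" using q by (simp add: \<beta>_def)
  have "4 powr (q - 1) < (1::real)" using q by (simp add: powr_less_one)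
  then have c: "0 < c" by (simp add: c_def)
  have C1: "0 < C1" unfolding C1_def using \<beta> D by (intro add_pos_nonneg add_pos_pos) auto
  show ?thesis
  proof (intro exI[of _ "1 / (1 - q) + C1 / c"] conjI allI impI)
    show "0 < 1 / (1 - q) + C1 / c" using q C1 c by (intro add_pos_pos) auto
    fix \<rho> a b :: real
    assume \<rho>: "0 < \<rho>" "\<rho> \<le> 1 / 100" and ab: "0 < a" "0 < b"
      and ln_a: "ln (a powr q) \<le> D * \<rho> powr (- 1 / q)"
    define x y E where "x = a powr q" and "y = b powr q" and "E = bd_energy q a b"
    have xy: "0 < x" "0 < y" using ab by (auto simp: x_def y_def)
    have E0: "0 \<le> E" using bd_energy_nonneg q ab by (simp add: E_def)
    have px: "0 \<le> phi x" and py: "0 \<le> phi y" using phi_nonneg xy by auto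
    have Csplit: "E / (1 - q) \<le> (1 / (1 - q) + C1 / c) * E" "C1 / c * E \<le> (1 / (1 - q) + C1 / c) * E"
      using E0 q C1 c by (auto simp: algebra_simps)
    \<comment> \<open>The threshold 16 forces \<open>x >= 4\<close> in the flat case, where
      \<open>x * ln x\<close> and \<open>phi x\<close> are comparable. The constants 50 and 32 of
      the first two cases are absorbed by \<open>2 * \<rho> <= 1 / 50\<close>.\<close>
    consider (small) "y \<le> 16" | (flat) "16 < y" "y \<le> 4 * x" | (jump) "16 < y" "4 * x < y"
      by linarith
    then have "2 * \<rho> * phi y \<le> phi x + (1 / (1 - q) + C1 / c) * E"
    proof cases
      case small
      have "phi y \<le> 25 * (sqrt y - 1)\<^sup>2" using phi_le_hellinger xy small by simp
      moreover have "(sqrt y - 1)\<^sup>2 \<le> 2 * (sqrt x - 1)\<^sup>2 + 2 * (sqrt y - sqrt x)\<^sup>2"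
        using square_add_le[of "sqrt x - 1" "sqrt y - sqrt x"] by simp
      moreover have "(sqrt x - 1)\<^sup>2 \<le> phi x" using hellinger_le_phi xy by simp
      moreover have "(sqrt y - sqrt x)\<^sup>2 \<le> E / (1 - q)"
        using powr_half_diff_le_bd_energy q ab by (simp add: x_def y_def E_def)
      ultimately have "phi y \<le> 50 * phi x + 50 * (E / (1 - q))" by linarith
      moreover have "2 * \<rho> * phi y \<le> 1 / 50 * phi y" using \<rho> py by (intro mult_right_mono) auto
      ultimately show ?thesis using Csplit by linarith
    next
      case flat
      have "4 \<le> x" using flat by linarith
      then have "ln 4 \<le> ln x" by simp
      then have "4 / 3 \<le> ln x"
        using ln4_ge by simp
      then have "x * (4 / 3) \<le> x * ln x" using xy by (intro mult_left_mono) auto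
      then have "x * ln x \<le> 4 * phi x" by (simp add: phi_def)
      moreover have "phi y \<le> y * ln y" using flat by (simp add: phi_def)
      moreover have "y * ln y \<le> 4 * x * (2 * ln x)"
      proof (rule mult_mono)
        have "ln y \<le> ln (4 * x)" using flat xy by simp
        also have "\<dots> = ln 4 + ln x" using xy by (simp add: ln_mult)
        finally show "ln y \<le> 2 * ln x" using \<open>ln 4 \<le> ln x\<close> by simp
      qed (use flat xy in auto)
      ultimately have "phi y \<le> 32 * phi x" by simp
      moreover have "2 * \<rho> * phi y \<le> 1 / 50 * phi y" using \<rho> py by (intro mult_right_mono) auto
      moreover have "0 \<le> (1 / (1 - q) + C1 / c) * E" using E0 q C1 c by simp
      ultimately show ?thesis using px by linarith
    next
      case jump
      define R where "R = y / x"
      have R: "4 < R" "y = R * x" using jump xy by (auto simp: R_def field_simps)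
      have R1: "1 \<le> R powr \<beta>" using R \<beta> by (simp add: ge_one_powr_ge_zero)
      have "2 * \<rho> * phi y \<le> 2 * \<rho> * (y * ln y)"
        using \<rho> jump by (intro mult_left_mono) (auto simp: phi_def)
      \<comment> \<open>The jump part \<open>ln R\<close> is dominated by the power
        \<open>R powr \<beta>\<close> that the energy supplies; the inherited part
        \<open>ln x\<close> needs a further case distinction.\<close>
      also have "\<dots> = 2 * \<rho> * y * ln R + 2 * \<rho> * y * ln x"
        using R xy by (simp add: ln_mult algebra_simps)
      also have "2 * \<rho> * y * ln R \<le> 2 / \<beta> * (y * R powr \<beta>)"
      proof -
        have "ln R \<le> R powr \<beta> / \<beta>" using R \<beta> by (intro ln_powr_bound) auto
        then have "2 * \<rho> * y * ln R \<le> 2 * \<rho> * y * (R powr \<beta> / \<beta>)"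
          using \<rho> xy by (intro mult_left_mono) auto
        also have "\<dots> \<le> 2 * 1 * y * (R powr \<beta> / \<beta>)"
          using \<rho> xy \<beta> by (intro mult_right_mono mult_left_mono) auto
        finally show ?thesis by simp
      qed
      also have "2 * \<rho> * y * ln x \<le> phi x + (6 + 2 * D * 8 powr \<beta>) * (y * R powr \<beta>)"
      proof -
        have yR: "y * 1 \<le> y * R powr \<beta>" using xy R1 by (intro mult_left_mono) auto
        have D0: "0 \<le> 2 * D * 8 powr \<beta> * (y * R powr \<beta>)" using D xy by simp
        \<comment> \<open>For bounded \<open>ln x\<close> the energy suffices. If
          \<open>\<rho> * R\<close> is small, then \<open>\<rho> * y = \<rho> * R * x\<close> is a
          small multiple of \<open>x\<close>, and \<open>phi x\<close> suffices. Otherwise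
          \<open>1 / \<rho> < 8 * R\<close>, so the hypothesis on \<open>ln x\<close> turns into a
          power of \<open>R\<close>.\<close>
        consider (s) "ln x \<le> 2" | (m) "2 < ln x" "8 * \<rho> * R \<le> 1" | (l) "2 < ln x" "1 < 8 * \<rho> * R"
          by linarith
        then show ?thesis
        proof cases
          case s
          have "2 * \<rho> * y * ln x \<le> 2 * \<rho> * y * 2" using \<rho> xy s by (intro mult_left_mono) auto
          also have "\<dots> \<le> 2 * 1 * y * 2" using \<rho> xy by (intro mult_right_mono mult_left_mono) auto
          finally show ?thesis unfolding distrib_right using yR D0 px xy by linarith
        next
          case m
          have "x * 2 \<le> x * ln x" using m xy by (intro mult_left_mono) auto
          then have "x * ln x \<le> 2 * phi x" by (simp add: phi_def)
          moreover have "2 * \<rho> * y * ln x = (8 * \<rho> * R) / 4 * (x * ln x)" using R by simp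
          moreover have "(8 * \<rho> * R) / 4 * (x * ln x) \<le> 1 / 4 * (x * ln x)"
            by (rule mult_right_mono[OF _ mult_nonneg_nonneg]) (use m xy in linarith)+
          moreover have "0 \<le> (6 + 2 * D * 8 powr \<beta>) * (y * R powr \<beta>)" using D xy by simp
          ultimately show ?thesis using px by linarith
        next
          case l
          have "\<rho> powr (- \<beta>) = (1 / \<rho>) powr \<beta>" using \<rho> by (simp add: powr_divide powr_minus_divide)
          also have "\<dots> \<le> (8 * R) powr \<beta>"
            using l \<rho> \<beta> by (intro powr_mono2) (auto simp: field_simps)
          also have "\<dots> = 8 powr \<beta> * R powr \<beta>" using R by (simp add: powr_mult)
          finally have rb: "\<rho> powr (- \<beta>) \<le> 8 powr \<beta> * R powr \<beta>" .
          have "\<rho> * ln x \<le> \<rho> * (D * \<rho> powr (- 1 / q))"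
            using ln_a \<rho> by (intro mult_left_mono) (auto simp: x_def)
          also have "\<dots> = D * (\<rho> * \<rho> powr (- 1 / q))" by simp
          also have "\<rho> * \<rho> powr (- 1 / q) = \<rho> powr (- \<beta>)"
          proof -
            have "1 + - 1 / q = - \<beta>" using q by (simp add: \<beta>_def field_simps)
            then show ?thesis using \<rho> by (simp add: powr_mult_base)
          qed
          also have "D * \<rho> powr (- \<beta>) \<le> D * (8 powr \<beta> * R powr \<beta>)"
            using rb D by (intro mult_left_mono)
          finally have "2 * y * (\<rho> * ln x) \<le> 2 * y * (D * (8 powr \<beta> * R powr \<beta>))"
            using xy by (intro mult_left_mono) auto
          moreover have "2 * \<rho> * y * ln x = 2 * y * (\<rho> * ln x)"
            and "2 * y * (D * (8 powr \<beta> * R powr \<beta>)) = 2 * D * 8 powr \<beta> * (y * R powr \<beta>)"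
            by simp_all
          moreover have "0 \<le> 6 * (y * R powr \<beta>)" using xy by simp
          ultimately show ?thesis unfolding distrib_right using px by linarith
        qed
      qed
      finally have "2 * \<rho> * phi y \<le> phi x + C1 * (y * R powr \<beta>)"
        by (simp add: C1_def algebra_simps)
      moreover have "c * (y * R powr \<beta>) \<le> E"
        using bd_energy_jump[OF q ab] jump
        by (simp add: c_def R_def \<beta>_def E_def x_def y_def)
      then have "C1 * (y * R powr \<beta>) \<le> C1 / c * E"
        using c C1 by (simp add: field_simps)
      ultimately show ?thesis using Csplit by linarith
    qed
    then show "2 * \<rho> * phi (b powr q) \<le> phi (a powr q) + (1 / (1 - q) + C1 / c) * bd_energy q a b"
      by (simp add: x_def y_def E_def)
  qed
qed


section \<open>Log-Sobolev inequalities on initial segments\<close>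

text \<open>Dividing the mean by the total mass makes this the entropy of the normalized weights
  times that mass. It is therefore linear under scaling of \<open>w\<close>, and weights need not
  sum to one.\<close>

definition fin_ent :: "(nat \<Rightarrow> real) \<Rightarrow> nat \<Rightarrow> (nat \<Rightarrow> real) \<Rightarrow> real" where
  "fin_ent w n g = (\<Sum>k\<le>n. w k * (g k * ln (g k)))
     - (\<Sum>k\<le>n. w k * g k) * ln ((\<Sum>k\<le>n. w k * g k) / (\<Sum>k\<le>n. w k))"

definition fin_energy :: "(nat \<Rightarrow> real) \<Rightarrow> nat \<Rightarrow> real \<Rightarrow> (nat \<Rightarrow> real) \<Rightarrow> real" where
  "fin_energy w n q f = (\<Sum>k<n. w k * bd_energy q (f k) (f (Suc k)))"

text \<open>\<open>K\<close> stands for \<open>C * q\<^sup>2 / (4 * (1 - q))\<close>, the constant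
  in front of the sign-reversed form in \<open>q\<close>-LS with constant \<open>C\<close>.\<close>

definition fin_LS :: "(nat \<Rightarrow> real) \<Rightarrow> nat \<Rightarrow> real \<Rightarrow> real \<Rightarrow> bool" where
  "fin_LS w n q K \<longleftrightarrow> (\<forall>f. (\<forall>k\<le>n. 0 < f k) \<longrightarrow>
     fin_ent w n (\<lambda>k. f k powr q) \<le> K * fin_energy w n q f)"

lemma fin_ent_scale_fun:
  assumes "\<And>k. k \<le> n \<Longrightarrow> 0 < w k" "\<And>k. k \<le> n \<Longrightarrow> 0 < g k" "0 < c"
  shows "fin_ent w n (\<lambda>k. c * g k) = c * fin_ent w n g"
proof -
  define G where "G = (\<Sum>k\<le>n. w k * g k)"
  define Z where "Z = (\<Sum>k\<le>n. w k)"
  have pos: "0 < G" "0 < Z" unfolding G_def Z_def using assms by (auto intro!: sum_pos)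
  have "(\<Sum>k\<le>n. w k * (c * g k * ln (c * g k)))
      = (\<Sum>k\<le>n. c * (w k * (g k * ln (g k))) + c * ln c * (w k * g k))"
    using assms by (intro sum.cong) (auto simp: ln_mult algebra_simps)
  also have "\<dots> = c * (\<Sum>k\<le>n. w k * (g k * ln (g k))) + c * ln c * G"
    by (simp add: sum.distrib sum_distrib_left G_def)
  finally have 1: "(\<Sum>k\<le>n. w k * (c * g k * ln (c * g k)))
    = c * (\<Sum>k\<le>n. w k * (g k * ln (g k))) + c * ln c * G" .
  have 2: "(\<Sum>k\<le>n. w k * (c * g k)) = c * G"
    by (simp add: sum_distrib_left G_def algebra_simps)
  have "ln (c * G / Z) = ln c + ln (G / Z)"
    using pos assms ln_mult[of c "G / Z"] by simp
  then show ?thesis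
    unfolding fin_ent_def 1 2 G_def[symmetric] Z_def[symmetric] by (simp add: algebra_simps)
qed

lemma fin_ent_scale_weight:
  assumes "c \<noteq> 0"
  shows "fin_ent (\<lambda>k. c * w k) n g = c * fin_ent w n g"
  using assms by (simp add: fin_ent_def sum_distrib_left[symmetric] mult.assoc right_diff_distrib)

lemma fin_energy_scale_weight: "fin_energy (\<lambda>k. c * w k) n q f = c * fin_energy w n q f"
  by (simp add: fin_energy_def sum_distrib_left mult.assoc)

lemma fin_LS_scale_weight:
  assumes "0 < c"
  shows "fin_LS (\<lambda>k. c * w k) n q K \<longleftrightarrow> fin_LS w n q K"
  using assms by (simp add: fin_LS_def fin_ent_scale_weight fin_energy_scale_weight mult.left_commute)

lemma bd_energy_scale:
  assumes "0 < c" "0 < a" "0 < b"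
  shows "bd_energy q (c * a) (c * b) = c powr q * bd_energy q a b"
proof -
  have "c powr q = c * c powr (q - 1)" using assms by (simp add: powr_mult_base)
  then show ?thesis using assms by (simp add: bd_energy_def powr_mult algebra_simps)
qed

lemma fin_energy_scale_fun:
  assumes "\<And>k. k \<le> n \<Longrightarrow> 0 < f k" "0 < c"
  shows "fin_energy w n q (\<lambda>k. c * f k) = c powr q * fin_energy w n q f"
  unfolding fin_energy_def sum_distrib_left
  using assms by (intro sum.cong) (auto simp: bd_energy_scale)

lemma fin_energy_nonneg:
  assumes "0 < q" "q < 1" "\<And>k. k \<le> n \<Longrightarrow> 0 < f k" "\<And>k. k \<le> n \<Longrightarrow> 0 < w k"
  shows "0 \<le> fin_energy w n q f"
  unfolding fin_energy_def
  using assms by (intro sum_nonneg mult_nonneg_nonneg bd_energy_nonneg) (auto intro: less_imp_le)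

lemma fin_ent_eq_phi:
  assumes "(\<Sum>k\<le>n. w k * g k) = (\<Sum>k\<le>n. w k)"
  shows "fin_ent w n g = (\<Sum>k\<le>n. w k * phi (g k))"
proof -
  have "(\<Sum>k\<le>n. w k * phi (g k))
      = (\<Sum>k\<le>n. w k * (g k * ln (g k))) - (\<Sum>k\<le>n. w k * g k) + (\<Sum>k\<le>n. w k)"
    by (simp add: phi_def algebra_simps sum.distrib sum_subtractf)
  then show ?thesis using assms by (simp add: fin_ent_def)
qed

text \<open>For \<open>f powr q\<close> of mean one, every value is at most \<open>2 / w k\<close>,
  so \<open>tail\<close> supplies the logarithmic hypothesis of \<open>phi_step\<close>. Summing the
  steps bounds the entropy by the energy and the term at 0, and a Poincare inequality for
  \<open>sqrt (f powr q)\<close> bounds that term. Nothing depends on \<open>n\<close>.\<close>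

lemma fin_LS_of_small_ratios:
  fixes w \<rho> :: "nat \<Rightarrow> real"
  assumes q: "0 < q" "q < 1" and D: "0 \<le> D"
    and w0: "w 0 = 1" and w_Suc: "\<And>k. w (Suc k) = w k * \<rho> k"
    and \<rho>: "\<And>k. 0 < \<rho> k" "\<And>k. \<rho> k \<le> 1 / 100"
    and tail: "\<And>k. ln (2 / w k) \<le> D * \<rho> k powr (- 1 / q)"
  shows "\<exists>K>0. \<forall>n. fin_LS w n q K"
proof -
  have w: "0 < w k" for k by (induction k) (auto simp: w0 w_Suc \<rho>)
  have w_half: "w (Suc k) \<le> w k / 100" for k
    using mult_left_mono[OF \<rho>(2), of "w k" k] w[of k] by (simp add: w_Suc)
  \<comment> \<open>Subtracting \<open>w n\<close> makes the induction close: it only asks for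
    \<open>2 * w (Suc n) <= w n\<close>.\<close>
  have mass: "(\<Sum>k\<le>n. w k) \<le> 2 - w n" for n
  proof (induction n)
    case (Suc n) then show ?case using w_half[of n] w[of n] by simp
  qed (simp add: w0)
  obtain C where C: "0 < C" and step: "\<And>\<rho> a b. \<lbrakk>0 < \<rho>; \<rho> \<le> 1 / 100; 0 < a; 0 < b;
      ln (a powr q) \<le> D * \<rho> powr (- 1 / q)\<rbrakk> \<Longrightarrow>
      2 * \<rho> * phi (b powr q) \<le> phi (a powr q) + C * bd_energy q a b"
    using phi_step[OF q D] by blast
  \<comment> \<open>The term at 0 will be at most \<open>50 * E / (1 - q)\<close>, and it enters
    twice: directly, and through the bound on the remaining terms.\<close>
  define K where "K = 100 / (1 - q) + C"
  have normalized: "fin_ent w n (\<lambda>k. f k powr q) \<le> K * fin_energy w n q f"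
    if f: "\<And>k. k \<le> n \<Longrightarrow> 0 < f k"
      and mean: "(\<Sum>k\<le>n. w k * f k powr q) = (\<Sum>k\<le>n. w k)" for n f
  proof -
    define g h E where "g k = f k powr q" and "h k = sqrt (g k)" and "E = fin_energy w n q f" for k
    have g: "0 < g k" if "k \<le> n" for k using f[OF that] by (simp add: g_def)
    have wg: "w k * g k \<le> 2" if "k \<le> n" for k
    proof -
      have "w k * g k \<le> (\<Sum>k\<le>n. w k * g k)"
        using that mult_nonneg_nonneg[OF less_imp_le[OF w] less_imp_le[OF g]] by (intro member_le_sum) auto
      also have "\<dots> \<le> 2" using mean mass[of n] w[of n] by (simp add: g_def)
      finally show ?thesis .
    qed
    have split0: "(\<Sum>k\<le>n. F k) = F 0 + (\<Sum>k<n. F (Suc k))" for F :: "nat \<Rightarrow> real"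
      by (simp add: sum.atMost_shift)
    define T where "T = (\<Sum>k<n. w (Suc k) * phi (g (Suc k)))"
    \<comment> \<open>Since \<open>w (Suc k) = w k * \<rho> k\<close>, each summand is the left side
      of \<open>phi_step\<close>. The right side contains \<open>T\<close> only once, so one copy
      can be cancelled.\<close>
    have "2 * T = (\<Sum>k<n. w k * (2 * \<rho> k * phi (g (Suc k))))"
      by (simp add: T_def sum_distrib_left w_Suc algebra_simps)
    also have "\<dots> \<le> (\<Sum>k<n. w k * (phi (g k) + C * bd_energy q (f k) (f (Suc k))))"
    proof (intro sum_mono mult_left_mono)
      fix k assume k: "k \<in> {..<n}"
      have "g k \<le> 2 / w k" using wg[of k] w[of k] k by (simp add: field_simps)
      then have "ln (g k) \<le> ln (2 / w k)" using g[of k] k by (subst ln_le_cancel_iff) (auto simp: w)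
      then have "ln (f k powr q) \<le> D * \<rho> k powr (- 1 / q)" using tail[of k] by (simp add: g_def)
      then show "2 * \<rho> k * phi (g (Suc k)) \<le> phi (g k) + C * bd_energy q (f k) (f (Suc k))"
        unfolding g_def using \<rho> f k by (intro step) auto
    qed (use w in \<open>auto intro: less_imp_le\<close>)
    also have "\<dots> = (\<Sum>k<n. w k * phi (g k)) + C * E"
      by (simp add: E_def fin_energy_def sum_distrib_left algebra_simps sum.distrib)
    also have "(\<Sum>k<n. w k * phi (g k)) \<le> (\<Sum>k\<le>n. w k * phi (g k))"
      using mult_nonneg_nonneg[OF less_imp_le[OF w] phi_nonneg[OF g]] by (intro sum_mono2) auto
    also have "(\<Sum>k\<le>n. w k * phi (g k)) = phi (g 0) + T" by (simp add: split0 T_def w0)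
    finally have T: "T \<le> phi (g 0) + C * E" by simp
    \<comment> \<open>Poincare inequality around the value at 0: a step at most doubles the squares
      of \<open>u\<close> and \<open>d\<close>, while the weight drops by a factor 100. Hence
      \<open>S\<close> reappears with a factor 1/50 and can be absorbed.\<close>
    define u d where "u k = h k - h 0" and "d k = h (Suc k) - h k" for k
    define S where "S = (\<Sum>k<n. w (Suc k) * (u (Suc k))\<^sup>2)"
    have sumu: "(\<Sum>k\<le>n. w k * (u k)\<^sup>2) = S" by (simp add: split0 S_def u_def)
    have "S \<le> (\<Sum>k<n. w k / 100 * (2 * (u k)\<^sup>2 + 2 * (d k)\<^sup>2))"
      unfolding S_def
    proof (intro sum_mono mult_mono w_half)
      fix k
      show "(u (Suc k))\<^sup>2 \<le> 2 * (u k)\<^sup>2 + 2 * (d k)\<^sup>2"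
        using square_add_le[of "u k" "d k"] by (simp add: u_def d_def)
    qed (use w in \<open>auto intro: less_imp_le\<close>)
    also have "\<dots> = ((\<Sum>k<n. w k * (u k)\<^sup>2) + (\<Sum>k<n. w k * (d k)\<^sup>2)) / 50"
      by (simp add: sum_divide_distrib sum.distrib[symmetric] algebra_simps add_divide_distrib)
    finally have "S \<le> ((\<Sum>k<n. w k * (u k)\<^sup>2) + (\<Sum>k<n. w k * (d k)\<^sup>2)) / 50" .
    moreover have "(\<Sum>k<n. w k * (u k)\<^sup>2) \<le> S"
      unfolding sumu[symmetric] using w by (intro sum_mono2) (auto simp: less_imp_le)
    moreover have "0 \<le> (\<Sum>k<n. w k * (d k)\<^sup>2)"
      using w by (intro sum_nonneg) (auto simp: less_imp_le)
    ultimately have "S \<le> (\<Sum>k<n. w k * (d k)\<^sup>2)" by argo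
    also have "\<dots> \<le> (\<Sum>k<n. w k * (bd_energy q (f k) (f (Suc k)) / (1 - q)))"
      unfolding d_def h_def g_def
      using w f q by (intro sum_mono mult_left_mono powr_half_diff_le_bd_energy) (auto intro: less_imp_le)
    finally have S: "S \<le> E / (1 - q)" by (simp add: E_def fin_energy_def sum_divide_distrib)
    define Z W where "Z = (\<Sum>k\<le>n. w k)" and "W = (\<Sum>k\<le>n. w k * h k)"
    have Z: "0 < Z" unfolding Z_def using w by (intro sum_pos) auto
    have hh: "(\<Sum>k\<le>n. w k * (h k)\<^sup>2) = Z"
      using mean g by (simp add: h_def g_def Z_def)
    \<comment> \<open>Used with \<open>c = 1\<close>, where it gives \<open>2 * (Z - W)\<close>, and
      with \<open>c = h 0\<close>, where it gives \<open>S\<close>. Completing the square in the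
      latter yields \<open>Z - W <= S\<close>, which moves the Poincare bound from the centre
      \<open>h 0\<close> to the centre 1.\<close>
    have square_dev: "(\<Sum>k\<le>n. w k * (h k - c)\<^sup>2) = Z - 2 * c * W + c\<^sup>2 * Z" for c
    proof -
      have "(\<Sum>k\<le>n. w k * (h k - c)\<^sup>2)
          = (\<Sum>k\<le>n. w k * (h k)\<^sup>2 - 2 * c * (w k * h k) + c\<^sup>2 * w k)"
        by (intro sum.cong) (auto simp: power2_eq_square algebra_simps)
      then show ?thesis by (simp add: sum.distrib sum_subtractf sum_distrib_left[symmetric] hh W_def Z_def)
    qed
    have W: "0 \<le> W" unfolding W_def h_def using w by (intro sum_nonneg) (auto simp: g_def less_imp_le)
    have dev1: "0 \<le> (\<Sum>k\<le>n. w k * (h k - 1)\<^sup>2)"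
      using w by (intro sum_nonneg) (auto simp: less_imp_le)
    have "(h 0 - 1)\<^sup>2 \<le> (\<Sum>k\<le>n. w k * (h k - 1)\<^sup>2)"
      unfolding split0 w0 using w sum_nonneg[of "{..<n}" "\<lambda>k. w (Suc k) * (h (Suc k) - 1)\<^sup>2"]
      by (simp add: less_imp_le)
    also have "\<dots> = 2 * (Z - W)" by (simp add: square_dev)
    also have "\<dots> \<le> 2 * S"
    proof -
      have ZW: "W \<le> Z" using dev1 by (simp add: square_dev)
      have "Z * S = Z * Z - W * W + (h 0 * Z - W)\<^sup>2"
        using square_dev[of "h 0"] unfolding sumu[unfolded u_def] by algebra
      then have "Z * S \<ge> Z * Z - W * W" by simp
      moreover have "W * W \<le> Z * W" using ZW W by (intro mult_right_mono)
      ultimately have "Z * (Z - W) \<le> Z * S" by (simp add: algebra_simps)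
      then show ?thesis using Z by simp
    qed
    finally have "(h 0 - 1)\<^sup>2 \<le> 2 * (E / (1 - q))" using S by linarith
    moreover have "phi (g 0) \<le> 25 * (h 0 - 1)\<^sup>2"
      unfolding h_def using g[of 0] wg[of 0] by (intro phi_le_hellinger) (auto simp: w0)
    ultimately have "phi (g 0) \<le> 50 * (E / (1 - q))" by linarith
    moreover have "fin_ent w n g = phi (g 0) + T"
      using fin_ent_eq_phi[where n = n and w = w and g = g] mean by (simp add: g_def split0 T_def w0)
    ultimately have "fin_ent w n g \<le> 100 * (E / (1 - q)) + C * E" using T by linarith
    then show ?thesis by (simp add: K_def E_def g_def[abs_def] algebra_simps)
  qed
  have "fin_LS w n q K" for n
    unfolding fin_LS_def
  proof (intro allI impI)
    fix f :: "nat \<Rightarrow> real" assume f: "\<forall>k\<le>n. 0 < f k"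
    define G Z where "G = (\<Sum>k\<le>n. w k * f k powr q)" and "Z = (\<Sum>k\<le>n. w k)"
    have pos: "0 < G" "0 < Z" unfolding G_def Z_def using w f by (auto intro!: sum_pos mult_pos_pos)
    \<comment> \<open>Scaling \<open>f\<close> by \<open>s\<close> brings \<open>f powr q\<close> to
      mean one; entropy and energy both acquire the factor \<open>Z / G\<close>.\<close>
    define s where "s = (Z / G) powr (1 / q)"
    have s: "0 < s" "s powr q = Z / G" using pos q by (auto simp: s_def powr_powr)
    have e: "(s * f k) powr q = Z / G * f k powr q" if "k \<le> n" for k
      using f that s by (simp add: powr_mult)
    have "(\<Sum>k\<le>n. w k * (s * f k) powr q) = (\<Sum>k\<le>n. Z / G * (w k * f k powr q))"
      by (intro sum.cong) (auto simp: e)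
    also have "\<dots> = Z / G * G" unfolding G_def sum_distrib_left ..
    also have "\<dots> = Z" using pos by simp
    finally have "fin_ent w n (\<lambda>k. (s * f k) powr q) \<le> K * fin_energy w n q (\<lambda>k. s * f k)"
      using f s by (intro normalized) (auto simp: Z_def)
    also have "fin_energy w n q (\<lambda>k. s * f k) = Z / G * fin_energy w n q f"
      using fin_energy_scale_fun[of n f s w q] f s by simp
    also have "fin_ent w n (\<lambda>k. (s * f k) powr q) = fin_ent w n (\<lambda>k. Z / G * f k powr q)"
      by (simp add: fin_ent_def e)
    also have "\<dots> = Z / G * fin_ent w n (\<lambda>k. f k powr q)"
      using f w pos by (intro fin_ent_scale_fun) auto
    finally have "Z / G * fin_ent w n (\<lambda>k. f k powr q) \<le> Z / G * (K * fin_energy w n q f)"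
      by (simp add: mult.left_commute)
    then show "fin_ent w n (\<lambda>k. f k powr q) \<le> K * fin_energy w n q f"
      using pos by (subst (asm) mult_le_cancel_left_pos) auto
  qed
  moreover have "0 < K" using C q by (simp add: K_def add_pos_pos)
  ultimately show ?thesis by blast
qed


section \<open>The counterexample weights\<close>

text \<open>The division by 100 provides the bound \<open>1 / 100\<close> on the ratios from the
  very first bond on, and the shift by 1 avoids a power of zero.\<close>

definition rho :: "real \<Rightarrow> nat \<Rightarrow> real" where
  "rho p k = (real k + 1) powr (- p) / 100"

definition wt :: "real \<Rightarrow> nat \<Rightarrow> real" where
  "wt p k = (\<Prod>j<k. rho p j)"

lemma wt_0: "wt p 0 = 1" and wt_Suc: "wt p (Suc k) = wt p k * rho p k"
  by (simp_all add: wt_def)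

lemma rho_pos: "0 < rho p k"
  by (simp add: rho_def)

lemma rho_le: "0 \<le> p \<Longrightarrow> rho p k \<le> 1 / 100"
  using powr_mono[of "- p" 0 "real k + 1"] by (simp add: rho_def)

lemma wt_pos: "0 < wt p k"
  by (simp add: wt_def prod_pos rho_pos)

lemma ln_wt: "ln (wt p k) = - (\<Sum>j<k. ln 100 + p * ln (real j + 1))"
proof (induction k)
  case (Suc k)
  have "ln (rho p k) = - (ln 100 + p * ln (real k + 1))"
    by (simp add: rho_def ln_div ln_powr)
  with Suc show ?case using wt_pos[of p k] rho_pos[of p k] by (simp add: wt_Suc ln_mult)
qed (simp add: wt_0)

text \<open>Here \<open>ln (1 / wt p k)\<close> grows at most like \<open>k * ln k\<close>, whereas
  \<open>rho p k powr (- 1 / q)\<close> is at least of order \<open>k powr (p / q)\<close>. As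
  \<open>p / q > 1\<close>, the surplus power absorbs the logarithm.\<close>

lemma fin_LS_below_exponent:
  assumes "0 < q" "q < p" "p < 1"
  shows "\<exists>K>0. \<forall>n. fin_LS (wt p) n q K"
\<comment> \<open>In \<open>D\<close>, 100 covers \<open>ln 100 <= 99\<close> together with
  \<open>ln 2 <= 1\<close>, and the other summand comes from bounding \<open>ln x\<close> by a
  multiple of \<open>x powr (p / q - 1)\<close>.\<close>
proof (rule fin_LS_of_small_ratios[where \<rho> = "rho p" and D = "100 + 1 / (p / q - 1)"])
  have pq: "1 < p / q" using assms by simp
  then show "0 \<le> 100 + 1 / (p / q - 1)" by simp
  fix k
  define x where "x = real k + 1"
  have x: "1 \<le> x" by (simp add: x_def)
  have l100: "ln (100::real) \<le> 99" using ln_le_minus_one[of "100::real"] by simp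
  have "(\<Sum>j<k. ln 100 + p * ln (real j + 1)) \<le> (\<Sum>j<k. 99 + ln x)"
  proof (intro sum_mono add_mono l100)
    fix j assume "j \<in> {..<k}"
    then have "p * ln (real j + 1) \<le> 1 * ln x"
      using assms x_def by (intro mult_mono) auto
    then show "p * ln (real j + 1) \<le> ln x" by simp
  qed
  then have "- ln (wt p k) \<le> real k * (99 + ln x)" by (simp add: ln_wt)
  also have "\<dots> \<le> x * (99 + ln x)" using x by (intro mult_right_mono) (auto simp: x_def)
  finally have "ln (2 / wt p k) \<le> ln 2 + x * (99 + ln x)"
    using wt_pos[of p k] by (simp add: ln_div)
  also have "\<dots> \<le> x * (100 + ln x)"
    using x ln_le_minus_one[of "2::real"] by (simp add: algebra_simps)
  also have "\<dots> \<le> x * (100 * x powr (p / q - 1) + x powr (p / q - 1) / (p / q - 1))"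
    using x pq ge_one_powr_ge_zero[of x "p / q - 1"] ln_powr_bound[of x "p / q - 1"]
    by (intro mult_left_mono add_mono) auto
  also have "\<dots> = (100 + 1 / (p / q - 1)) * (x * x powr (p / q - 1))" by (simp add: algebra_simps)
  also have "x * x powr (p / q - 1) = x powr (p / q)" using x by (simp add: powr_mult_base)
  also have "(100 + 1 / (p / q - 1)) * x powr (p / q) \<le> (100 + 1 / (p / q - 1)) * rho p k powr (- 1 / q)"
  proof (intro mult_left_mono)
    have "rho p k powr (- 1 / q) = x powr (p / q) * 100 powr (1 / q)"
      using x assms
      by (simp add: rho_def x_def powr_divide powr_powr powr_minus_divide powr_mult)
    moreover have "x powr (p / q) * 1 \<le> x powr (p / q) * 100 powr (1 / q)"
      using assms by (intro mult_left_mono ge_one_powr_ge_zero) auto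
    ultimately show "x powr (p / q) \<le> rho p k powr (- 1 / q)" by simp
  qed (use pq in auto)
  finally show "ln (2 / wt p k) \<le> (100 + 1 / (p / q - 1)) * rho p k powr (- 1 / q)" .
qed (use assms rho_le[of p] in \<open>simp_all add: wt_0 wt_Suc rho_pos\<close>)

text \<open>A crude substitute for Stirling's formula: every factor from \<open>m\<close> on
  contributes at least \<open>ln m\<close>. With \<open>m\<close> fixed but arbitrarily large, this
  still gives growth faster than any fixed multiple of \<open>k\<close>.\<close>

lemma sum_ln_ge:
  assumes "1 \<le> m"
  shows "(real k - real m) * ln (real m) \<le> (\<Sum>j<k. ln (real j + 1))"
proof (induction k)
  case 0 then show ?case using assms by simp
next
  case (Suc k)
  show ?case
  proof (cases "m \<le> Suc k")
    case True
    then have "ln (real m) \<le> ln (real k + 1)" using assms by simp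
    with Suc show ?thesis by (simp add: algebra_simps)
  next
    case False
    then have "(real (Suc k) - real m) * ln (real m) \<le> 0"
      using assms by (intro mult_nonpos_nonneg) auto
    also have "0 \<le> (\<Sum>j<Suc k. ln (real j + 1))" by (intro sum_nonneg) auto
    finally show ?thesis .
  qed
qed

text \<open>The test function is \<open>f\<^sup>p = 1 / wt p\<close>: all of its level sets carry the same weight, the entropy
  is of order \<open>n\<^sup>2 ln n\<close> and the energy only of order \<open>n\<^sup>2\<close>.\<close>

lemma not_fin_LS_at_exponent:
  assumes p: "0 < p" "p < 1"
  shows "\<not> (\<forall>n. fin_LS (wt p) n p K)"
proof
  assume LS: "\<forall>n. fin_LS (wt p) n p K"
  define f where "f k = wt p k powr (- 1 / p)" for k
  define B where "B = \<bar>K\<bar> * 100 powr (1 / p)"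
  have f: "0 < f k" for k using wt_pos[of p k] by (simp add: f_def)
  have fp: "f k powr p = 1 / wt p k" for k
  proof -
    have "f k powr p = wt p k powr - 1" using p by (simp only: f_def powr_powr) simp
    then show ?thesis using wt_pos[of p k] by (simp add: powr_minus_divide)
  qed
  \<comment> \<open>The exponent \<open>- 1 / p\<close> cancels the power \<open>- p\<close> in
    \<open>rho\<close>, so the growth factor is linear in \<open>k\<close>; this puts the energy at
    order \<open>n\<^sup>2\<close>.\<close>
  have ratio: "f (Suc k) = f k * (100 powr (1 / p) * (real k + 1))" for k
    using p wt_pos[of p k]
    by (simp add: f_def wt_Suc rho_def powr_mult powr_divide powr_powr powr_minus_divide)
  have energy: "fin_energy (wt p) n p f \<le> 100 powr (1 / p) * (\<Sum>k<n. real k + 1)" for n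
    unfolding fin_energy_def sum_distrib_left
  proof (intro sum_mono)
    fix k
    have "bd_energy p (f k) (f (Suc k)) \<le> f (Suc k) * f k powr (p - 1)"
    proof -
      have "1 * 1 \<le> 100 powr (1 / p) * (real k + 1)"
        using p by (intro mult_mono ge_one_powr_ge_zero) auto
      then have "f k \<le> f (Suc k)" using f[of k] ratio[of k] by simp
      moreover from this have "f (Suc k) powr (p - 1) \<le> f k powr (p - 1)"
        using f p by (intro powr_mono2') auto
      ultimately show ?thesis unfolding bd_energy_def using f
        by (intro mult_mono) (auto simp: less_imp_le)
    qed
    also have "\<dots> = f k powr p * (100 powr (1 / p) * (real k + 1))"
      using f[of k] by (simp add: ratio powr_diff)
    finally have "wt p k * bd_energy p (f k) (f (Suc k))
        \<le> wt p k * (f k powr p * (100 powr (1 / p) * (real k + 1)))"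
      using wt_pos[of p k] by (intro mult_left_mono) auto
    then show "wt p k * bd_energy p (f k) (f (Suc k)) \<le> 100 powr (1 / p) * (real k + 1)"
      using wt_pos[of p k] by (simp add: fp)
  qed
  have bound: "p * (real n / 2 - real m) * ln (real m) \<le> real n + B * real n" if m: "1 \<le> m" for m n
  proof -
    have Z: "1 \<le> (\<Sum>k\<le>n. wt p k)"
      using member_le_sum[of 0 "{..n}" "wt p"] by (auto simp: wt_0 wt_pos less_imp_le)
    have mean: "(\<Sum>k\<le>n. wt p k * f k powr p) = real n + 1"
      using wt_pos[of p] by (simp add: fp less_imp_neq[symmetric])
    have "(\<Sum>k\<le>n. wt p k * (f k powr p * ln (f k powr p)))
        = (\<Sum>k\<le>n. \<Sum>j<k. ln 100 + p * ln (real j + 1))"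
      using wt_pos[of p] by (intro sum.cong) (auto simp: fp ln_div ln_wt less_imp_neq[symmetric])
    also have "\<dots> \<ge> (\<Sum>k\<le>n. p * ((real k - real m) * ln (real m)))"
    proof (intro sum_mono)
      fix k
      have "p * ((real k - real m) * ln (real m)) \<le> p * (\<Sum>j<k. ln (real j + 1))"
        using p m by (intro mult_left_mono sum_ln_ge) auto
      also have "\<dots> \<le> (\<Sum>j<k. ln 100 + p * ln (real j + 1))"
        unfolding sum_distrib_left by (intro sum_mono) auto
      finally show "p * ((real k - real m) * ln (real m)) \<le> (\<Sum>j<k. ln 100 + p * ln (real j + 1))" .
    qed
    also have "(\<Sum>k\<le>n. p * ((real k - real m) * ln (real m)))
        = p * ln (real m) * (\<Sum>k\<le>n. real k - real m)"
      by (simp add: sum_distrib_left algebra_simps)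
    also have "(\<Sum>k\<le>n. real k - real m) = (real n + 1) * (real n / 2 - real m)"
      by (induction n) (auto simp: field_simps)
    finally have ent1: "p * ln (real m) * ((real n + 1) * (real n / 2 - real m))
        \<le> (\<Sum>k\<le>n. wt p k * (f k powr p * ln (f k powr p)))" .
    \<comment> \<open>The subtracted mean term is only of order \<open>n\<^sup>2\<close>, below the
      main term with its factor \<open>ln m\<close>.\<close>
    have "ln ((real n + 1) / (\<Sum>k\<le>n. wt p k)) \<le> ln (real n + 1)"
      using Z divide_left_mono[of 1 "\<Sum>k\<le>n. wt p k" "real n + 1"]
      by (subst ln_le_cancel_iff) auto
    also have "\<dots> \<le> real n" using ln_le_minus_one[of "real n + 1"] by simp
    finally have "(real n + 1) * ln ((real n + 1) / (\<Sum>k\<le>n. wt p k)) \<le> (real n + 1) * real n"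
      by (intro mult_left_mono) auto
    with ent1 have "p * ln (real m) * ((real n + 1) * (real n / 2 - real m)) - (real n + 1) * real n
        \<le> fin_ent (wt p) n (\<lambda>k. f k powr p)"
      unfolding fin_ent_def mean by linarith
    also have "\<dots> \<le> K * fin_energy (wt p) n p f" using LS f by (auto simp: fin_LS_def)
    also have "\<dots> \<le> \<bar>K\<bar> * (100 powr (1 / p) * (\<Sum>k<n. real k + 1))"
      using fin_energy_nonneg[OF p, of n f "wt p"] f wt_pos energy by (intro mult_mono) auto
    also have "(\<Sum>k<n. real k + 1) = (real n + 1) * (real n / 2)"
      by (induction n) (auto simp: field_simps)
    finally have main: "p * ln (real m) * ((real n + 1) * (real n / 2 - real m)) - (real n + 1) * real n
        \<le> \<bar>K\<bar> * (100 powr (1 / p) * ((real n + 1) * (real n / 2)))" .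
    have "p * ln (real m) * ((real n + 1) * (real n / 2 - real m))
        = (real n + 1) * (p * ln (real m) * (real n / 2 - real m))" by simp
    moreover have "\<bar>K\<bar> * (100 powr (1 / p) * ((real n + 1) * (real n / 2)))
        = (real n + 1) * (B * (real n / 2))" by (simp add: B_def)
    ultimately have "(real n + 1) * (p * ln (real m) * (real n / 2 - real m))
        \<le> (real n + 1) * (real n + B * (real n / 2))"
      using main unfolding distrib_left[of _ "real n"] by linarith
    then have "p * ln (real m) * (real n / 2 - real m) \<le> real n + B * (real n / 2)"
      by (subst (asm) mult_le_cancel_left_pos) auto
    moreover have "B * (real n / 2) \<le> B * real n" by (intro mult_left_mono) (auto simp: B_def)
    ultimately show ?thesis by (simp add: mult_ac)
  qed
  \<comment> \<open>With this \<open>m\<close> the left side of \<open>bound\<close> has slope at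
    least \<open>B + 2\<close> in \<open>n\<close>, while the right side has slope
    \<open>B + 1\<close>; hence all \<open>n\<close> would be bounded.\<close>
  define m where "m = nat \<lceil>exp (2 * (B + 2) / p)\<rceil>"
  have "exp (2 * (B + 2) / p) \<le> real m" unfolding m_def by linarith
  moreover have "0 < exp (2 * (B + 2) / p)" by simp
  ultimately have m: "1 \<le> m" "2 * (B + 2) / p \<le> ln (real m)"
    by (linarith, subst ln_ge_iff) linarith+
  have "real n \<le> p * real m * ln (real m)" for n
  proof -
    have "2 * (B + 2) \<le> p * ln (real m)" using m p by (simp add: field_simps)
    then have "2 * (B + 2) * (real n / 2) \<le> p * ln (real m) * (real n / 2)"
      by (intro mult_right_mono) auto
    with bound[OF m(1), of n] show ?thesis by (simp add: algebra_simps)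
  qed
  then show False using reals_Archimedean2[of "p * real m * ln (real m)"] by (meson not_less)
qed

section \<open>The infinite birth-death chain\<close>

lemma wt_summable:
  assumes "0 \<le> p" shows "summable (wt p)"
proof (rule summable_ratio_test[of "1 / 100" 0])
  fix n
  show "norm (wt p (Suc n)) \<le> 1 / 100 * norm (wt p n)"
    using mult_left_mono[OF rho_le[OF assms], of "wt p n" n] wt_pos[of p] rho_pos[of p n]
    by (simp add: wt_Suc less_imp_le abs_mult)
qed simp

lemma ex_pmf_wt:
  assumes "0 \<le> p"
  shows "\<exists>\<mu> :: nat pmf. \<exists>c>0. pmf \<mu> = (\<lambda>k. c * wt p k)"
proof -
  define Z where "Z = (\<Sum>k. wt p k)"
  have Z: "0 < Z" unfolding Z_def using wt_summable[OF assms] wt_pos by (intro suminf_pos) auto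
  have "(\<integral>\<^sup>+k. ennreal (wt p k / Z) \<partial>count_space UNIV) = (\<Sum>k. ennreal (wt p k / Z))"
    by (rule nn_integral_count_space_nat)
  also have "\<dots> = ennreal (\<Sum>k. wt p k / Z)"
    using Z wt_pos[of p] summable_divide[OF wt_summable[OF assms], of Z]
    by (intro suminf_ennreal2) (auto simp: less_imp_le)
  also have "(\<Sum>k. wt p k / Z) = 1"
    using Z suminf_divide[OF wt_summable[OF assms], of Z] by (simp add: Z_def)
  finally have "pmf (embed_pmf (\<lambda>k. wt p k / Z)) k = wt p k / Z" for k
    using Z wt_pos[of p] by (intro pmf_embed_pmf) (auto simp: less_imp_le)
  then show ?thesis using Z
    by (intro exI[of _ "embed_pmf (\<lambda>k. wt p k / Z)"] exI[of _ "1 / Z"]) auto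
qed

lemma integral_pmf_tendsto:
  fixes \<mu> :: "nat pmf" and F :: "nat \<Rightarrow> real"
  assumes "integrable (measure_pmf \<mu>) F"
  shows "(\<lambda>n. \<Sum>k\<le>n. pmf \<mu> k * F k) \<longlonglongrightarrow> (\<integral>k. F k \<partial>measure_pmf \<mu>)"
proof -
  have "(\<lambda>n. \<integral>k. indicator {..n} k * F k \<partial>measure_pmf \<mu>) \<longlonglongrightarrow> (\<integral>k. F k \<partial>measure_pmf \<mu>)"
  proof (rule integral_dominated_convergence[where w = "\<lambda>k. \<bar>F k\<bar>"])
    show "AE k in measure_pmf \<mu>. (\<lambda>n. indicator {..n} k * F k) \<longlonglongrightarrow> F k"
    proof (intro AE_I2)
      fix k
      have "eventually (\<lambda>n. indicator {..n} k * F k = F k) sequentially"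
        using eventually_ge_at_top[of k] by eventually_elim simp
      then show "(\<lambda>n. indicator {..n} k * F k) \<longlonglongrightarrow> F k" by (rule tendsto_eventually)
    qed
  qed (use assms in \<open>auto simp: indicator_def\<close>)
  moreover have "(\<integral>k. indicator {..n} k * F k \<partial>measure_pmf \<mu>) = (\<Sum>k\<le>n. pmf \<mu> k * F k)" for n
    by (subst integral_measure_pmf_real[of "{..n}"]) (auto simp: indicator_def intro!: sum.cong split: if_splits)
  ultimately show ?thesis by simp
qed

lemma neg_ln_le: "0 < x \<Longrightarrow> 1 - 1 / x \<le> ln x" for x :: real
  using ln_le_minus_one[of "1 / x"] by (simp add: ln_div)

lemma abs_mult_ln_le:
  fixes x :: real
  assumes "0 < x" shows "\<bar>x * ln x\<bar> \<le> 1 + x\<^sup>2"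
proof -
  have "x * ln x \<le> x * (x - 1)" using assms ln_le_minus_one by (intro mult_left_mono) auto
  then have 1: "x * ln x \<le> x\<^sup>2 - x" by (simp add: power2_eq_square algebra_simps)
  have "x * (1 - 1 / x) \<le> x * ln x" using assms neg_ln_le by (intro mult_left_mono) auto
  then have "x - 1 \<le> x * ln x" using assms by (simp add: algebra_simps)
  with 1 show ?thesis using assms by (simp add: abs_le_iff) (smt (verit) zero_le_power2)
qed

text \<open>Square integrability dominates both \<open>g\<close> and \<open>g * ln g\<close> through
  \<open>1 + (g k)\<^sup>2\<close>, so the truncated sums converge.\<close>

lemma fin_ent_tendsto_Ent:
  fixes \<mu> :: "nat pmf" and g :: "nat \<Rightarrow> real"
  assumes pos: "\<And>k. 0 < pmf \<mu> k" "\<And>k. 0 < g k"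
    and int: "integrable (measure_pmf \<mu>) (\<lambda>k. (g k)\<^sup>2)"
  shows "(\<lambda>n. fin_ent (pmf \<mu>) n g) \<longlonglongrightarrow> Ent (measure_pmf \<mu>) g"
proof -
  have int1: "integrable (measure_pmf \<mu>) (\<lambda>k. 1 + (g k)\<^sup>2)" using int by simp
  have ig: "integrable (measure_pmf \<mu>) g"
  proof (rule Bochner_Integration.integrable_bound[OF int1])
    show "AE k in measure_pmf \<mu>. norm (g k) \<le> norm (1 + (g k)\<^sup>2)"
    proof (intro AE_I2)
      fix k
      have "0 \<le> (g k - 1)\<^sup>2" by simp
      then have "2 * g k \<le> 1 + (g k)\<^sup>2" by (simp add: power2_eq_square algebra_simps)
      then show "norm (g k) \<le> norm (1 + (g k)\<^sup>2)" using pos(2)[of k] by simp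
    qed
  qed simp
  have iln: "integrable (measure_pmf \<mu>) (\<lambda>k. g k * ln (g k))"
    by (rule Bochner_Integration.integrable_bound[OF int1])
      (use abs_mult_ln_le[OF pos(2)] in \<open>auto intro!: AE_I2\<close>)
  define G where "G = (\<integral>k. g k \<partial>measure_pmf \<mu>)"
  have tG: "(\<lambda>n. \<Sum>k\<le>n. pmf \<mu> k * g k) \<longlonglongrightarrow> G"
    unfolding G_def by (rule integral_pmf_tendsto[OF ig])
  have tm: "(\<lambda>n. \<Sum>k\<le>n. pmf \<mu> k) \<longlonglongrightarrow> 1"
    using integral_pmf_tendsto[of \<mu> "\<lambda>_. 1"] by simp
  have "pmf \<mu> 0 * g 0 \<le> (\<Sum>k\<le>n. pmf \<mu> k * g k)" for n
    using pos by (intro member_le_sum) (auto simp: less_imp_le)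
  \<comment> \<open>The limit of the means must be positive for \<open>ln\<close> to be continuous
    there.\<close>
  then have "pmf \<mu> 0 * g 0 \<le> G" using tG by (intro LIMSEQ_le_const) auto
  then have G: "0 < G" using mult_pos_pos[OF pos(1)[of 0] pos(2)[of 0]] by linarith
  have "(\<lambda>n. fin_ent (pmf \<mu>) n g) \<longlonglongrightarrow> (\<integral>k. g k * ln (g k) \<partial>measure_pmf \<mu>) - G * ln (G / 1)"
    unfolding fin_ent_def using G
    by (intro tendsto_diff tendsto_mult tendsto_ln tendsto_divide tG tm integral_pmf_tendsto[OF iln]) auto
  then show ?thesis by (simp add: Ent_def G_def)
qed

lemma integrable_powr_square:
  fixes f :: "'a \<Rightarrow> real"
  assumes q: "0 < q" "q < 1" and "finite_measure M" and "\<And>x. 0 < f x"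
    and f: "f \<in> borel_measurable M" "integrable M (\<lambda>x. (f x)\<^sup>2)"
  shows "integrable M (\<lambda>x. (f x powr q)\<^sup>2)"
proof (rule Bochner_Integration.integrable_bound)
  interpret finite_measure M by fact
  show "integrable M (\<lambda>x. 1 + (f x)\<^sup>2)" using f by simp
  show "AE x in M. norm ((f x powr q)\<^sup>2) \<le> norm (1 + (f x)\<^sup>2)"
  proof (intro AE_I2)
    fix x
    have "(f x powr q)\<^sup>2 = (f x)\<^sup>2 powr q"
      using assms(4)[of x] by (simp add: power2_eq_square powr_mult)
    also have "\<dots> \<le> 1 + (f x)\<^sup>2"
    proof (cases "(f x)\<^sup>2 \<le> 1")
      case True then show ?thesis
        using powr_mono2[of q "(f x)\<^sup>2" 1] q by (simp add: add_increasing2)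
    next
      case False
      then have "(f x)\<^sup>2 powr q \<le> (f x)\<^sup>2 powr 1" using q by (intro powr_mono) auto
      then show ?thesis by simp
    qed
    finally show "norm ((f x powr q)\<^sup>2) \<le> norm (1 + (f x)\<^sup>2)" by simp
  qed
qed (use f in simp)

lemma abs_mult_le_squares: "\<bar>x * y\<bar> \<le> x\<^sup>2 + y\<^sup>2" for x y :: real
proof -
  have "2 * \<bar>x\<bar> * \<bar>y\<bar> \<le> x\<^sup>2 + y\<^sup>2" using sum_squares_bound[of "\<bar>x\<bar>" "\<bar>y\<bar>"] by simp
  moreover have "0 \<le> \<bar>x\<bar> * \<bar>y\<bar>" by simp
  ultimately show ?thesis unfolding abs_mult by linarith
qed

text \<open>Both sides of the truncated inequality converge. The energy series converges absolutely
  because \<open>f\<close> and \<open>f powr (q - 1)\<close> lie in the domain, and the entropy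
  converges because \<open>f powr q\<close> is again square integrable.\<close>

lemma birth_death_LS_of_fin_LS:
  fixes \<mu> :: "nat pmf"
  assumes q: "0 < q" "q < 1" and pos: "\<And>k. 0 < pmf \<mu> k" and LS: "\<And>n. fin_LS (pmf \<mu>) n q K"
  shows "birth_death_LS (measure_pmf \<mu>) q (4 * (1 - q) / q\<^sup>2 * K)"
proof -
  let ?M = "measure_pmf \<mu>"
  have "Ent ?M (\<lambda>x. f x powr q)
      \<le> (4 * (1 - q) / q\<^sup>2 * K) * q\<^sup>2 / (4 * (q - 1)) * birth_death_form ?M (\<lambda>x. f x powr (q - 1)) f"
    if f: "f \<in> positive_members ?M (birth_death_domain ?M)"
      and f': "(\<lambda>x. f x powr (q - 1)) \<in> positive_members ?M (birth_death_domain ?M)" for f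
  proof -
    have fpos: "0 < f k" for k using f by (auto simp: positive_members_def)
    let ?a = "\<lambda>k. f (k + 1) powr (q - 1) - f k powr (q - 1)" and ?b = "\<lambda>k. f (k + 1) - f k"
    have "summable (\<lambda>k. (?a k)\<^sup>2 * pmf \<mu> k + (?b k)\<^sup>2 * pmf \<mu> k)"
      using f f' by (intro summable_add)
        (auto simp: positive_members_def birth_death_domain_def measure_pmf_single)
    then have "summable (\<lambda>k. ?a k * ?b k * pmf \<mu> k)"
    proof (rule summable_comparison_test'[where N = 0])
      fix k
      have "\<bar>?a k * ?b k\<bar> \<le> (?a k)\<^sup>2 + (?b k)\<^sup>2" by (rule abs_mult_le_squares)
      then have "\<bar>?a k * ?b k\<bar> * pmf \<mu> k \<le> ((?a k)\<^sup>2 + (?b k)\<^sup>2) * pmf \<mu> k"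
        by (intro mult_right_mono) auto
      then show "norm (?a k * ?b k * pmf \<mu> k) \<le> (?a k)\<^sup>2 * pmf \<mu> k + (?b k)\<^sup>2 * pmf \<mu> k"
        by (simp add: abs_mult distrib_right)
    qed
    then have "(\<lambda>n. - (\<Sum>k<n. ?a k * ?b k * pmf \<mu> k)) \<longlonglongrightarrow> - birth_death_form ?M (\<lambda>x. f x powr (q - 1)) f"
      unfolding birth_death_form_def measure_pmf_single
      by (intro tendsto_minus summable_LIMSEQ)
    moreover have "- (\<Sum>k<n. ?a k * ?b k * pmf \<mu> k) = fin_energy (pmf \<mu>) n q f" for n
      by (simp add: fin_energy_def bd_energy_def sum_negf[symmetric] algebra_simps)
    ultimately have "(\<lambda>n. K * fin_energy (pmf \<mu>) n q f) \<longlonglongrightarrow> K * - birth_death_form ?M (\<lambda>x. f x powr (q - 1)) f"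
      by (intro tendsto_mult_left) simp
    moreover have "(\<lambda>n. fin_ent (pmf \<mu>) n (\<lambda>k. f k powr q)) \<longlonglongrightarrow> Ent ?M (\<lambda>k. f k powr q)"
      using f fpos by (intro fin_ent_tendsto_Ent pos integrable_powr_square q measure_pmf.finite_measure_axioms)
        (auto simp: positive_members_def birth_death_domain_def L2_def less_imp_neq[OF fpos, symmetric])
    ultimately have "Ent ?M (\<lambda>k. f k powr q) \<le> K * - birth_death_form ?M (\<lambda>x. f x powr (q - 1)) f"
      using LS fpos by (intro LIMSEQ_le) (auto simp: fin_LS_def)
    also have "\<dots> = (4 * (1 - q) / q\<^sup>2 * K) * q\<^sup>2 / (4 * (q - 1)) * birth_death_form ?M (\<lambda>x. f x powr (q - 1)) f"
    proof -
      have "(4 * (1 - q) / q\<^sup>2 * K) * q\<^sup>2 / (4 * (q - 1)) = - K" using q by (simp add: field_simps)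
      then show ?thesis by simp
    qed
    finally show ?thesis .
  qed
  then show ?thesis using q by (simp add: log_sobolev_def)
qed

section \<open>Test functions frozen beyond a given point\<close>

lemma stopped_bounded: "\<bar>F (min k n)\<bar> \<le> (\<Sum>j\<le>n. \<bar>F j\<bar>)" for F :: "nat \<Rightarrow> real"
  by (rule member_le_sum) auto

lemma integrable_stopped:
  fixes \<mu> :: "nat pmf" and F :: "nat \<Rightarrow> real"
  shows "integrable (measure_pmf \<mu>) (\<lambda>k. F (min k n))"
  by (rule measure_pmf.integrable_const_bound[where B = "\<Sum>j\<le>n. \<bar>F j\<bar>"])
    (auto simp: stopped_bounded intro!: AE_I2)

lemma stopped_in_domain:
  fixes \<mu> :: "nat pmf" and F :: "nat \<Rightarrow> real"
  shows "(\<lambda>k. F (min k n)) \<in> birth_death_domain (measure_pmf \<mu>)"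
proof -
  have "summable (\<lambda>k. (F (min (k + 1) n) - F (min k n))\<^sup>2 * pmf \<mu> k)"
    by (rule summable_finite[of "{..<n}"]) (auto simp: min_def not_less)
  then show ?thesis
    using integrable_stopped[of \<mu> "\<lambda>k. (F k)\<^sup>2" n]
    by (simp add: birth_death_domain_def L2_def measure_pmf_single)
qed

lemma integral_stopped:
  fixes \<mu> :: "nat pmf" and F :: "nat \<Rightarrow> real"
  shows "(\<integral>k. F (min k n) \<partial>measure_pmf \<mu>)
    = (\<Sum>k\<le>n. pmf \<mu> k * F k) + (1 - (\<Sum>k\<le>n. pmf \<mu> k)) * F n"
proof -
  have "(\<integral>k. F (min k n) - F n \<partial>measure_pmf \<mu>) = (\<Sum>k\<le>n. (F (min k n) - F n) * pmf \<mu> k)"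
    by (rule integral_measure_pmf_real) (auto simp: min_def split: if_splits)
  also have "\<dots> = (\<Sum>k\<le>n. pmf \<mu> k * F k - pmf \<mu> k * F n)"
    by (intro sum.cong) (auto simp: algebra_simps)
  also have "(\<integral>k. F (min k n) - F n \<partial>measure_pmf \<mu>) = (\<integral>k. F (min k n) \<partial>measure_pmf \<mu>) - F n"
    using integrable_stopped[of \<mu> F n] by simp
  finally show ?thesis by (simp add: sum_subtractf flip: sum_distrib_right) (simp add: algebra_simps)
qed

text \<open>A function on \<open>{..n}\<close> is extended by freezing it at \<open>n\<close>. The
  bonds beyond \<open>n\<close> then carry no energy, and by convexity the constant tail can only
  increase the entropy.\<close>

lemma fin_LS_of_birth_death_LS:
  fixes \<mu> :: "nat pmf"
  assumes p: "0 < p" "p < 1" and pos: "\<And>k. 0 < pmf \<mu> k" and LS: "birth_death_LS (measure_pmf \<mu>) p C"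
  shows "fin_LS (pmf \<mu>) n p (C * p\<^sup>2 / (4 * (1 - p)))"
  unfolding fin_LS_def
proof (intro allI impI)
  let ?M = "measure_pmf \<mu>"
  fix f :: "nat \<Rightarrow> real" assume f: "\<forall>k\<le>n. 0 < f k"
  define h g where "h k = f (min k n)" and "g k = f k powr p" for k
  have dom: "h \<in> positive_members ?M (birth_death_domain ?M)"
    "(\<lambda>k. h k powr (p - 1)) \<in> positive_members ?M (birth_death_domain ?M)"
    using f stopped_in_domain[where F = f] stopped_in_domain[where F = "\<lambda>k. f k powr (p - 1)"]
    by (auto simp: positive_members_def h_def[abs_def])
      (metis less_irrefl min.cobounded2)+
  have "birth_death_form ?M (\<lambda>k. h k powr (p - 1)) h
      = (\<Sum>k<n. (h (k + 1) powr (p - 1) - h k powr (p - 1)) * (h (k + 1) - h k) * pmf \<mu> k)"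
    unfolding birth_death_form_def measure_pmf_single
    by (rule suminf_finite) (auto simp: h_def min_def not_less)
  also have "\<dots> = - fin_energy (pmf \<mu>) n p f"
    unfolding fin_energy_def bd_energy_def sum_negf[symmetric]
    by (intro sum.cong) (auto simp: h_def min_def algebra_simps)
  finally have form: "birth_death_form ?M (\<lambda>k. h k powr (p - 1)) h = - fin_energy (pmf \<mu>) n p f" .
  define m G c where "m = (\<Sum>k\<le>n. pmf \<mu> k)" and "G = (\<Sum>k\<le>n. pmf \<mu> k * g k)"
    and "c = G + (1 - m) * g n"
  have m: "0 < m" unfolding m_def using pos by (intro sum_pos) auto
  have G: "0 < G" unfolding G_def g_def using pos f by (intro sum_pos mult_pos_pos) auto
  have m1: "m \<le> 1" unfolding m_def
    using measure_pmf.prob_le_1[of \<mu> "{..n}"]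
    by (simp add: measure_measure_pmf_finite)
  have gn: "0 < g n" using f by (auto simp: g_def)
  have c: "0 < c" unfolding c_def using G m1 gn by (intro add_pos_nonneg mult_nonneg_nonneg) auto
  have "Ent ?M (\<lambda>k. h k powr p) = (\<Sum>k\<le>n. pmf \<mu> k * (g k * ln (g k))) + (1 - m) * (g n * ln (g n)) - c * ln c"
    using integral_stopped[where F = "\<lambda>k. g k * ln (g k)"] integral_stopped[where F = g]
    by (simp add: Ent_def h_def g_def m_def c_def G_def)
  \<comment> \<open>Jensen's inequality for \<open>x * ln x\<close> with two points: mass
    \<open>m\<close> at \<open>G / m\<close> and mass \<open>1 - m\<close> at \<open>g n\<close>,
    whose mean is \<open>c\<close>. It is derived from \<open>ln x >= 1 - 1 / x\<close>, applied
    relative to \<open>c\<close>.\<close>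
  moreover have "c * ln c \<le> G * ln (G / m) + (1 - m) * (g n * ln (g n))"
  proof -
    have "G * (1 - 1 / (G / (m * c))) \<le> G * ln (G / (m * c))"
      using G m c by (intro mult_left_mono neg_ln_le) auto
    moreover have "ln (G / (m * c)) = ln (G / m) - ln c"
      using G m c by (simp add: ln_div ln_mult)
    moreover have "(1 - m) * g n * (1 - 1 / (g n / c)) \<le> (1 - m) * g n * ln (g n / c)"
      using gn m1 c by (intro mult_left_mono neg_ln_le) auto
    moreover have "ln (g n / c) = ln (g n) - ln c" using gn c by (simp add: ln_div)
    moreover have "G * (1 - 1 / (G / (m * c))) + (1 - m) * g n * (1 - 1 / (g n / c)) = 0"
      using G gn by (simp add: c_def field_simps)
    ultimately have "0 \<le> G * (ln (G / m) - ln c) + (1 - m) * g n * (ln (g n) - ln c)" by simp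
    then show ?thesis by (simp add: c_def algebra_simps)
  qed
  ultimately have "fin_ent (pmf \<mu>) n g \<le> Ent ?M (\<lambda>k. h k powr p)"
    by (simp add: fin_ent_def m_def G_def)
  also have "\<dots> \<le> C * p\<^sup>2 / (4 * (p - 1)) * birth_death_form ?M (\<lambda>k. h k powr (p - 1)) h"
    using LS dom p by (simp add: log_sobolev_def)
  also have "\<dots> = C * p\<^sup>2 / (4 * (1 - p)) * fin_energy (pmf \<mu>) n p f"
    unfolding form using p by (simp add: field_simps)
  finally show "fin_ent (pmf \<mu>) n (\<lambda>k. f k powr p) \<le> C * p\<^sup>2 / (4 * (1 - p)) * fin_energy (pmf \<mu>) n p f"
    by (simp add: g_def[abs_def])
qed

lemma discrete_prob_space_pmf:
  fixes \<mu> :: "'a pmf"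
  assumes "\<And>x. 0 < pmf \<mu> x"
  shows "discrete_prob_space (measure_pmf \<mu>)"
  by standard (use assms in \<open>auto simp: measure_pmf_single\<close>)

theorem birth_death_counterexample:
  assumes p: "0 < p" "p < 1"
  shows "\<exists>M :: nat measure. discrete_prob_space M \<and> space M = UNIV \<and>
         \<not> (\<exists>C>0. birth_death_LS M p C) \<and>
         (\<forall>q. 0 < q \<and> q < p \<longrightarrow> (\<exists>C>0. birth_death_LS M q C))"
proof -
  obtain \<mu> :: "nat pmf" and c where c: "0 < c" and \<mu>: "pmf \<mu> = (\<lambda>k. c * wt p k)"
    using ex_pmf_wt[of p] p by auto
  have pos: "0 < pmf \<mu> k" for k using c wt_pos[of p k] by (simp add: \<mu>)
  have fin: "fin_LS (pmf \<mu>) n q K \<longleftrightarrow> fin_LS (wt p) n q K" for n q K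
    unfolding \<mu> using c by (rule fin_LS_scale_weight)
  have "\<not> birth_death_LS (measure_pmf \<mu>) p C" for C
    using fin_LS_of_birth_death_LS[OF p pos, of C] not_fin_LS_at_exponent[OF p]
    unfolding fin by blast
  moreover have "\<exists>C>0. birth_death_LS (measure_pmf \<mu>) q C" if q: "0 < q" "q < p" for q
  proof -
    obtain K where K: "0 < K" "\<And>n. fin_LS (wt p) n q K"
      using fin_LS_below_exponent[OF q p(2)] by auto
    show ?thesis
    proof (intro exI conjI)
      show "birth_death_LS (measure_pmf \<mu>) q (4 * (1 - q) / q\<^sup>2 * K)"
        using q p K by (intro birth_death_LS_of_fin_LS pos) (auto simp: fin)
      show "0 < 4 * (1 - q) / q\<^sup>2 * K" using q p K by simp
    qed
  qed
  ultimately show ?thesis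
    using discrete_prob_space_pmf[OF pos] by (intro exI[of _ "measure_pmf \<mu>"]) auto
qed

section \<open>Reversible Markov semigroups on finite sets\<close>

lemma measure_point_measure:
  assumes "finite A" "X \<subseteq> A" "\<And>a. a \<in> A \<Longrightarrow> 0 \<le> w a"
  shows "measure (point_measure A (\<lambda>a. ennreal (w a))) X = (\<Sum>a\<in>X. w a)"
proof -
  have "emeasure (point_measure A (\<lambda>a. ennreal (w a))) X = ennreal (\<Sum>a\<in>X. w a)"
    using assms by (simp add: emeasure_point_measure_finite subset_iff)
  then show ?thesis using assms by (simp add: measure_def sum_nonneg subset_iff)
qed

lemma prob_space_point_measure':
  assumes "finite A" "\<And>a. a \<in> A \<Longrightarrow> 0 \<le> w a" "(\<Sum>a\<in>A. w a) = 1"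
  shows "prob_space (point_measure A (\<lambda>a. ennreal (w a)))"
  using assms by (intro prob_space_point_measure) auto

text \<open>\<open>K\<close> is the transition matrix of a discrete-time chain reversible for
  \<open>m\<close>, and \<open>r\<close> is the rate of the Poisson clock that triggers its
  steps.\<close>

locale finite_reversible_kernel =
  fixes n :: nat and m :: "nat \<Rightarrow> real" and K :: "nat \<Rightarrow> nat \<Rightarrow> real" and r :: real
  assumes m_pos: "x \<le> n \<Longrightarrow> 0 < m x" and m_sum: "(\<Sum>x\<le>n. m x) = 1"
    and K_nonneg: "x \<le> n \<Longrightarrow> y \<le> n \<Longrightarrow> 0 \<le> K x y"
    and K_sum: "x \<le> n \<Longrightarrow> (\<Sum>y\<le>n. K x y) = 1"
    and K_rev: "x \<le> n \<Longrightarrow> y \<le> n \<Longrightarrow> m x * K x y = m y * K y x"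
    and r_pos: "0 < r"
begin

section \<open>Powers and exponential of a reversible stochastic matrix\<close>

primrec Kpow :: "nat \<Rightarrow> nat \<Rightarrow> nat \<Rightarrow> real" where
  "Kpow 0 x y = of_bool (x = y)"
| "Kpow (Suc j) x y = (\<Sum>z\<le>n. K x z * Kpow j z y)"

lemma Kpow_nonneg: "x \<le> n \<Longrightarrow> y \<le> n \<Longrightarrow> 0 \<le> Kpow j x y"
  by (induction j arbitrary: x) (auto intro!: sum_nonneg mult_nonneg_nonneg K_nonneg)

lemma Kpow_sum: "x \<le> n \<Longrightarrow> (\<Sum>y\<le>n. Kpow j x y) = 1"
proof (induction j arbitrary: x)
  case (Suc j)
  have "(\<Sum>y\<le>n. Kpow (Suc j) x y) = (\<Sum>z\<le>n. K x z * (\<Sum>y\<le>n. Kpow j z y))"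
    unfolding Kpow.simps sum_distrib_left by (rule sum.swap)
  with Suc show ?case by (simp add: K_sum)
qed simp

lemma Kpow_le_1:
  assumes "x \<le> n" "y \<le> n" shows "Kpow j x y \<le> 1"
  using assms member_le_sum[of y "{..n}" "Kpow j x"] by (simp add: Kpow_sum Kpow_nonneg)

lemma Kpow_add:
  assumes "x \<le> n"
  shows "Kpow (i + j) x y = (\<Sum>z\<le>n. Kpow i x z * Kpow j z y)"
  using assms
proof (induction i arbitrary: x)
  case (Suc i)
  have "Kpow (Suc i + j) x y = (\<Sum>w\<le>n. \<Sum>z\<le>n. K x w * Kpow i w z * Kpow j z y)"
    using Suc by (simp add: sum_distrib_left mult.assoc)
  also have "\<dots> = (\<Sum>z\<le>n. \<Sum>w\<le>n. K x w * Kpow i w z * Kpow j z y)" by (rule sum.swap)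
  finally show ?case by (simp add: sum_distrib_right)
qed simp

lemma Kpow_1: "y \<le> n \<Longrightarrow> Kpow (Suc 0) x y = K x y"
  by simp

lemma Kpow_rev:
  assumes "x \<le> n" "y \<le> n"
  shows "m x * Kpow j x y = m y * Kpow j y x"
  using assms
proof (induction j arbitrary: x y)
  case (Suc j)
  have "m x * Kpow (Suc j) x y = (\<Sum>z\<le>n. (m x * K x z) * Kpow j z y)"
    by (simp add: sum_distrib_left mult.assoc)
  \<comment> \<open>Reversal turns the factor \<open>K\<close> on the left into one on the right,
    whereas the recursion of \<open>Kpow\<close> peels on the left; \<open>Kpow_add\<close>
    reconciles the two.\<close>
  also have "\<dots> = (\<Sum>z\<le>n. m y * (Kpow j y z * Kpow (Suc 0) z x))"
  proof (intro sum.cong refl)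
    fix z assume z: "z \<in> {..n}"
    have "(m x * K x z) * Kpow j z y = K z x * (m z * Kpow j z y)"
      using K_rev[of x z] z Suc.prems by simp
    also have "\<dots> = K z x * (m y * Kpow j y z)" using Suc.IH[of z y] z Suc.prems by simp
    finally show "m x * K x z * Kpow j z y = m y * (Kpow j y z * Kpow (Suc 0) z x)"
      using Suc.prems Kpow_1[of x z] by (simp del: Kpow.simps)
  qed
  also have "\<dots> = m y * Kpow (j + Suc 0) y x"
    using Suc.prems by (simp only: Kpow_add sum_distrib_left)
  finally show ?case by simp
qed auto

text \<open>The matrix exponential of \<open>s\<close> times \<open>K\<close>.\<close>

definition E :: "real \<Rightarrow> nat \<Rightarrow> nat \<Rightarrow> real" where
  "E s x y = (\<Sum>j. (s ^ j / fact j) * Kpow j x y)"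

lemma E_summable_norm:
  assumes "x \<le> n" "y \<le> n"
  shows "summable (\<lambda>j. norm ((s ^ j / fact j) * Kpow j x y))"
proof (rule summable_comparison_test'[where N = 0])
  show "summable (\<lambda>j. norm (s ^ j / fact j))"
    using summable_norm_exp[of s] by (simp add: divide_inverse mult.commute)
  fix j
  have "norm (s ^ j / fact j) * Kpow j x y \<le> norm (s ^ j / fact j) * 1"
    using Kpow_le_1[OF assms] by (intro mult_left_mono) auto
  then show "norm (norm ((s ^ j / fact j) * Kpow j x y)) \<le> norm (s ^ j / fact j)"
    using Kpow_nonneg[OF assms] by (simp add: abs_mult)
qed

lemma E_sums:
  assumes "x \<le> n" "y \<le> n"
  shows "(\<lambda>j. (s ^ j / fact j) * Kpow j x y) sums E s x y"
  unfolding E_def using E_summable_norm[OF assms, THEN summable_norm_cancel] by (rule summable_sums)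

lemma exp_term_add:
  fixes s t :: real
  shows "(s + t) ^ k / fact k = (\<Sum>i\<le>k. (s ^ i / fact i) * (t ^ (k - i) / fact (k - i)))"
  using exp_series_add_commuting[of s t k] by (simp add: divide_inverse mult.commute)

text \<open>The Cauchy product of two absolutely convergent series: the matrix powers combine by
  \<open>Kpow_add\<close>, the scalar coefficients by the binomial theorem in
  \<open>exp_term_add\<close>.\<close>

lemma E_add:
  assumes xy: "x \<le> n" "y \<le> n"
  shows "E (s + t) x y = (\<Sum>z\<le>n. E s x z * E t z y)"
proof -
  let ?a = "\<lambda>s x y j. (s ^ j / fact j) * Kpow j x y"
  have "(\<lambda>k. \<Sum>z\<le>n. \<Sum>i\<le>k. ?a s x z i * ?a t z y (k - i)) sums (\<Sum>z\<le>n. E s x z * E t z y)"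
    unfolding E_def using xy
    by (intro sums_sum Cauchy_product_sums E_summable_norm) auto
  moreover have "(\<Sum>z\<le>n. \<Sum>i\<le>k. ?a s x z i * ?a t z y (k - i)) = ?a (s + t) x y k" for k
  proof -
    have "(\<Sum>z\<le>n. \<Sum>i\<le>k. ?a s x z i * ?a t z y (k - i))
        = (\<Sum>i\<le>k. \<Sum>z\<le>n. ?a s x z i * ?a t z y (k - i))" by (rule sum.swap)
    also have "\<dots> = (\<Sum>i\<le>k. (s ^ i / fact i) * (t ^ (k - i) / fact (k - i)) * Kpow (i + (k - i)) x y)"
      unfolding Kpow_add[OF xy(1)] sum_distrib_left by (intro sum.cong) auto
    also have "\<dots> = (\<Sum>i\<le>k. (s ^ i / fact i) * (t ^ (k - i) / fact (k - i))) * Kpow k x y"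
      unfolding sum_distrib_right by (intro sum.cong) auto
    finally show ?thesis by (simp only: exp_term_add)
  qed
  ultimately show ?thesis using E_sums[OF xy] by (metis (no_types, lifting) sums_cong sums_unique2)
qed

lemma E_sum:
  assumes "x \<le> n" shows "(\<Sum>y\<le>n. E s x y) = exp s"
proof -
  have "(\<lambda>j. \<Sum>y\<le>n. (s ^ j / fact j) * Kpow j x y) sums (\<Sum>y\<le>n. E s x y)"
    using assms by (intro sums_sum E_sums) auto
  moreover have "(\<Sum>y\<le>n. (s ^ j / fact j) * Kpow j x y) = s ^ j /\<^sub>R fact j" for j
    using Kpow_sum[OF assms] by (simp add: sum_distrib_left[symmetric] divide_inverse)
  ultimately have "(\<lambda>j. s ^ j /\<^sub>R fact j) sums (\<Sum>y\<le>n. E s x y)" by simp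
  then show ?thesis using exp_converges[of s] by (rule sums_unique2)
qed

text \<open>The zeroth term of a series of nonnegative terms. It gives both nonnegativity and the
  lower bound on the diagonal.\<close>

lemma E_ge:
  assumes "x \<le> n" "y \<le> n" "0 \<le> s" shows "of_bool (x = y) \<le> E s x y"
proof -
  have "(\<Sum>j<1. (s ^ j / fact j) * Kpow j x y) \<le> E s x y"
    unfolding E_def using assms Kpow_nonneg[OF assms(1,2)]
    by (intro sum_le_suminf summable_norm_cancel[OF E_summable_norm]) auto
  then show ?thesis by simp
qed

lemma E_rev:
  assumes "x \<le> n" "y \<le> n" shows "m x * E s x y = m y * E s y x"
proof -
  have "(\<lambda>j. m x * ((s ^ j / fact j) * Kpow j x y)) sums (m x * E s x y)"
    using assms by (intro sums_mult E_sums)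
  moreover have "(\<lambda>j. m y * ((s ^ j / fact j) * Kpow j y x)) sums (m y * E s y x)"
    using assms by (intro sums_mult E_sums)
  moreover have "(\<lambda>j. m x * ((s ^ j / fact j) * Kpow j x y)) = (\<lambda>j. m y * ((s ^ j / fact j) * Kpow j y x))"
    using Kpow_rev[OF assms] by (simp add: fun_eq_iff)
  ultimately show ?thesis by (metis sums_unique2)
qed

lemma E_deriv:
  assumes "x \<le> n" "y \<le> n"
  shows "((\<lambda>s. E s x y) has_field_derivative K x y) (at 0)"
proof -
  let ?c = "\<lambda>j. Kpow j x y / fact j"
  have "((\<lambda>s. \<Sum>j. ?c j * s ^ j) has_field_derivative (\<Sum>j. diffs ?c j * 0 ^ j)) (at 0)"
    using E_summable_norm[OF assms, THEN summable_norm_cancel]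
    by (intro termdiffs_strong_converges_everywhere) (simp add: mult.commute)
  moreover have "diffs ?c 0 = K x y"
    using Kpow_1[OF assms(2)] by (simp add: diffs_def del: Kpow.simps)
  then have "(\<Sum>j. diffs ?c j * 0 ^ j) = K x y" by (simp only: powser_zero)
  moreover have "(\<Sum>j. ?c j * s ^ j) = E s x y" for s by (simp add: E_def mult.commute)
  ultimately show ?thesis by simp
qed

text \<open>The semigroup with generator \<open>r * (K - 1)\<close>.\<close>

definition trans_prob :: "real \<Rightarrow> nat \<Rightarrow> nat \<Rightarrow> real" where
  "trans_prob t x y = exp (- (r * t)) * E (r * t) x y"

lemma trans_prob_nonneg: "x \<le> n \<Longrightarrow> y \<le> n \<Longrightarrow> 0 \<le> t \<Longrightarrow> 0 \<le> trans_prob t x y"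
  using E_ge[of x y "r * t"] r_pos order_trans[OF zero_less_eq_of_bool] unfolding trans_prob_def
  by (intro mult_nonneg_nonneg) auto

lemma trans_prob_sum: "x \<le> n \<Longrightarrow> (\<Sum>y\<le>n. trans_prob t x y) = 1"
  by (simp add: trans_prob_def sum_distrib_left[symmetric] E_sum flip: exp_add)

lemma trans_prob_add:
  assumes "x \<le> n" "y \<le> n"
  shows "trans_prob (s + t) x y = (\<Sum>z\<le>n. trans_prob s x z * trans_prob t z y)"
proof -
  have "exp (- (r * (s + t))) = exp (- (r * s)) * exp (- (r * t))"
    by (simp add: algebra_simps flip: exp_add)
  then show ?thesis
    using E_add[OF assms, of "r * s" "r * t"]
    by (simp add: trans_prob_def distrib_left sum_distrib_left mult_ac)
qed

lemma trans_prob_rev: "x \<le> n \<Longrightarrow> y \<le> n \<Longrightarrow> m x * trans_prob t x y = m y * trans_prob t y x"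
  using E_rev[of x y "r * t"] by (simp add: trans_prob_def)

lemma trans_prob_0: "trans_prob 0 x y = of_bool (x = y)"
  using powser_zero[of "\<lambda>j. Kpow j x y / fact j"] by (simp add: trans_prob_def E_def mult.commute)

text \<open>The diagonal entry is at least \<open>exp (- (r * t)) >= 1 - r * t\<close>, and the row
  sums to 1. The bound is uniform in \<open>t\<close>, which puts every function into the domain of
  the form.\<close>

lemma trans_prob_le:
  assumes "x \<le> n" "y \<le> n" "x \<noteq> y" "0 \<le> t"
  shows "trans_prob t x y \<le> r * t"
proof -
  have "exp (- (r * t)) * 1 \<le> trans_prob t x x"
    unfolding trans_prob_def using E_ge[of x x "r * t"] assms r_pos by (intro mult_left_mono) auto
  moreover have "1 - r * t \<le> exp (- (r * t))" using exp_ge_add_one_self[of "- (r * t)"] by simp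
  moreover have "trans_prob t x x + trans_prob t x y \<le> 1"
  proof -
    have "(\<Sum>z\<in>{x, y}. trans_prob t x z) \<le> (\<Sum>z\<le>n. trans_prob t x z)"
      using assms by (intro sum_mono2 trans_prob_nonneg) auto
    then show ?thesis using assms by (simp add: trans_prob_sum)
  qed
  ultimately show ?thesis by simp
qed

lemma trans_prob_deriv:
  assumes "x \<le> n" "y \<le> n"
  shows "((\<lambda>t. trans_prob t x y) has_field_derivative r * (K x y - of_bool (x = y))) (at 0)"
proof -
  have "((\<lambda>t. E (r * t) x y) has_field_derivative K x y * r) (at 0)"
    using E_deriv[OF assms] by (intro DERIV_chain'[where g = "\<lambda>s. E s x y"]) (auto intro!: derivative_eq_intros)
  moreover have "E 0 x y = of_bool (x = y)" using trans_prob_0[of x y] by (simp add: trans_prob_def)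
  ultimately show ?thesis unfolding trans_prob_def
    by (auto intro!: derivative_eq_intros simp: algebra_simps)
qed

lemma trans_prob_tendsto:
  assumes "x \<le> n" "y \<le> n"
  shows "((\<lambda>t. trans_prob t x y) \<longlongrightarrow> of_bool (x = y)) (at_right 0)"
  using DERIV_isCont[OF trans_prob_deriv[OF assms]]
  by (auto simp: isCont_def trans_prob_0 intro: tendsto_within_subset)

lemma trans_prob_rate_tendsto:
  assumes "x \<le> n" "y \<le> n" "x \<noteq> y"
  shows "((\<lambda>t. trans_prob t x y / t) \<longlongrightarrow> r * K x y) (at_right 0)"
  using trans_prob_deriv[OF assms(1,2)] assms(3)
  by (auto simp: DERIV_def trans_prob_0 intro: tendsto_within_subset)

section \<open>The transition probabilities as a Markov semigroup and its Dirichlet form\<close>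

definition M :: "nat measure" where
  "M = point_measure {..n} (\<lambda>x. ennreal (m x))"

definition P :: "real \<Rightarrow> nat \<Rightarrow> nat measure" where
  "P t x = point_measure {..n} (\<lambda>y. ennreal (trans_prob t x y))"

lemma space_M [simp]: "space M = {..n}" and sets_M [simp]: "sets M = Pow {..n}"
  by (simp_all add: M_def point_measure_def)

lemma space_P [simp]: "space (P t x) = {..n}" and sets_P [simp]: "sets (P t x) = Pow {..n}"
  by (simp_all add: P_def point_measure_def)

lemma integral_M: "(\<integral>x. f x \<partial>M) = (\<Sum>x\<le>n. m x * f x)" for f :: "nat \<Rightarrow> real"
  unfolding M_def using m_pos by (subst lebesgue_integral_point_measure_finite) (auto simp: less_imp_le)

lemma integral_P: "x \<le> n \<Longrightarrow> 0 \<le> t \<Longrightarrow> (\<integral>y. f y \<partial>P t x) = (\<Sum>y\<le>n. trans_prob t x y * f y)" for f :: "nat \<Rightarrow> real"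
  unfolding P_def using trans_prob_nonneg by (subst lebesgue_integral_point_measure_finite) auto

lemma measure_M: "A \<subseteq> {..n} \<Longrightarrow> measure M A = (\<Sum>x\<in>A. m x)"
  unfolding M_def using m_pos by (intro measure_point_measure) (auto simp: less_imp_le)

lemma measure_P: "x \<le> n \<Longrightarrow> 0 \<le> t \<Longrightarrow> A \<subseteq> {..n} \<Longrightarrow> measure (P t x) A = (\<Sum>y\<in>A. trans_prob t x y)"
  unfolding P_def using trans_prob_nonneg by (intro measure_point_measure) auto

lemma sum_indicator_Iic:
  "A \<subseteq> {..n} \<Longrightarrow> (\<Sum>x\<le>n. m x * (indicator A x * f x)) = (\<Sum>x\<in>A. m x * f x)" for f :: "nat \<Rightarrow> real"
  by (subst sum.mono_neutral_right[of "{..n}" A]) (auto simp: indicator_def intro!: sum.cong)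

lemma reversible_markov: "reversible_markov M P"
proof -
  interpret prob_space M
    unfolding M_def using m_pos m_sum by (intro prob_space_point_measure') (auto simp: less_imp_le)
  show ?thesis
  proof
    show "sets M = Pow (space M)" by simp
    show "0 < measure M {x}" if "x \<in> space M" for x using that m_pos by (simp add: measure_M)
    show "P t \<in> M \<rightarrow>\<^sub>M prob_algebra M" if "0 \<le> t" for t
    proof (rule measurableI)
      fix x assume "x \<in> space M"
      then show "P t x \<in> space (prob_algebra M)"
        unfolding space_prob_algebra using that
        by (auto simp: trans_prob_nonneg trans_prob_sum) (auto simp: P_def trans_prob_nonneg trans_prob_sum intro!: prob_space_point_measure')
    qed auto
    show "P 0 x = return M x" if "x \<in> space M" for x
    proof (rule measure_eqI)
      fix A assume "A \<in> sets (P 0 x)"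
      then have A: "A \<subseteq> {..n}" by simp
      then have "emeasure (P 0 x) A = (\<Sum>y\<in>A. ennreal (of_bool (x = y)))"
        unfolding P_def trans_prob_0 by (subst emeasure_point_measure_finite) auto
      also have "\<dots> = (\<Sum>y\<in>A. if x = y then 1 else 0)" by (intro sum.cong) auto
      also have "\<dots> = indicator A x" using finite_subset[OF A] by (simp add: indicator_def)
      finally show "emeasure (P 0 x) A = emeasure (return M x) A" using A by simp
    qed simp
    show "measure (P (s + t) x) A = (\<integral>y. measure (P t y) A \<partial>(P s x))"
      if st: "0 \<le> s" "0 \<le> t" and x: "x \<in> space M" and A: "A \<in> sets M" for s t x A
    proof -
      have "(\<integral>y. measure (P t y) A \<partial>(P s x)) = (\<Sum>y\<le>n. trans_prob s x y * (\<Sum>z\<in>A. trans_prob t y z))"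
        using x st A by (simp add: integral_P measure_P)
      also have "\<dots> = (\<Sum>z\<in>A. \<Sum>y\<le>n. trans_prob s x y * trans_prob t y z)"
        unfolding sum_distrib_left by (rule sum.swap)
      also have "\<dots> = (\<Sum>z\<in>A. trans_prob (s + t) x z)"
        using x A by (intro sum.cong) (auto simp: trans_prob_add)
      also have "\<dots> = measure (P (s + t) x) A" using x st A by (simp add: measure_P)
      finally show ?thesis by simp
    qed
    show "(\<integral>x. measure (P t x) A \<partial>M) = measure M A" if t: "0 \<le> t" and A: "A \<in> sets M" for t A
    proof -
      have "(\<integral>x. measure (P t x) A \<partial>M) = (\<Sum>x\<le>n. \<Sum>y\<in>A. m x * trans_prob t x y)"
        using t A by (simp add: integral_M measure_P sum_distrib_left)
      \<comment> \<open>Invariance follows from reversibility: after the exchange the inner sums are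
        row sums.\<close>
      also have "\<dots> = (\<Sum>y\<in>A. \<Sum>x\<le>n. m y * trans_prob t y x)"
        using A by (subst sum.swap) (auto simp: trans_prob_rev intro!: sum.cong)
      also have "\<dots> = measure M A"
        using A by (auto simp: sum_distrib_left[symmetric] trans_prob_sum measure_M intro!: sum.cong)
      finally show ?thesis .
    qed
    show "(LINT x:A|M. measure (P t x) B) = (LINT x:B|M. measure (P t x) A)"
      if t: "0 \<le> t" and A: "A \<in> sets M" and B: "B \<in> sets M" for t A B
    proof -
      have *: "(LINT x:A|M. measure (P t x) B) = (\<Sum>x\<in>A. \<Sum>y\<in>B. m x * trans_prob t x y)"
        if "A \<subseteq> {..n}" "B \<subseteq> {..n}" for A B
      proof -
        have "(LINT x:A|M. measure (P t x) B) = (\<Sum>x\<in>A. m x * measure (P t x) B)"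
          using that by (simp add: set_lebesgue_integral_def integral_M sum_indicator_Iic)
        also have "\<dots> = (\<Sum>x\<in>A. \<Sum>y\<in>B. m x * trans_prob t x y)"
          using that t by (intro sum.cong) (auto simp: measure_P sum_distrib_left)
        finally show ?thesis .
      qed
      have "(\<Sum>x\<in>A. \<Sum>y\<in>B. m x * trans_prob t x y) = (\<Sum>y\<in>B. \<Sum>x\<in>A. m y * trans_prob t y x)"
        using A B by (subst sum.swap) (auto simp: subset_iff trans_prob_rev[of _ _ t] intro!: sum.cong)
      then show ?thesis using A B by (simp add: *)
    qed
    show "((\<lambda>t. \<integral>x. (semigroup_op P t f x - f x)\<^sup>2 \<partial>M) \<longlongrightarrow> 0) (at_right 0)" for f
    proof -
      \<comment> \<open>On a finite set entrywise convergence of the transition probabilities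
        suffices.\<close>
      have "((\<lambda>t. \<Sum>x\<le>n. m x * ((\<Sum>y\<le>n. trans_prob t x y * f y) - f x)\<^sup>2)
          \<longlongrightarrow> (\<Sum>x\<le>n. m x * ((\<Sum>y\<le>n. of_bool (x = y) * f y) - f x)\<^sup>2)) (at_right 0)"
        by (intro tendsto_sum tendsto_mult tendsto_power tendsto_diff tendsto_const trans_prob_tendsto) auto
      also have "(\<Sum>x\<le>n. m x * ((\<Sum>y\<le>n. of_bool (x = y) * f y) - f x)\<^sup>2) = 0"
        by (intro sum.neutral) auto
      finally show ?thesis
        by (rule Lim_transform_eventually)
          (auto simp: eventually_at_filter integral_M semigroup_op_def integral_P intro!: sum.cong always_eventually)
    qed
  qed
qed

lemma dirichlet_approx_eq:
  assumes "0 < t"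
  shows "dirichlet_approx M P t f g
    = (\<Sum>x\<le>n. \<Sum>y\<le>n. m x * (trans_prob t x y / t) * ((f x - f y) * (g x - g y)) / 2)"
  using assms
  by (simp add: dirichlet_approx_def integral_M integral_P sum_divide_distrib sum_distrib_left mult_ac)

text \<open>Diagonal terms vanish with the differences, and off the diagonal
  \<open>trans_prob t x y / t\<close> tends to the jump rate \<open>r * K x y\<close>.\<close>

lemma markov_form_eq:
  "markov_form M P f g = (\<Sum>x\<le>n. \<Sum>y\<le>n. m x * (r * K x y) * ((f x - f y) * (g x - g y)) / 2)"
  unfolding markov_form_def
proof (rule tendsto_Lim)
  have "((\<lambda>t. \<Sum>x\<le>n. \<Sum>y\<le>n. m x * (trans_prob t x y / t) * ((f x - f y) * (g x - g y)) / 2)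
      \<longlongrightarrow> (\<Sum>x\<le>n. \<Sum>y\<le>n. m x * (r * K x y) * ((f x - f y) * (g x - g y)) / 2)) (at_right 0)"
  proof (intro tendsto_sum)
    fix x y assume xy: "x \<in> {..n}" "y \<in> {..n}"
    show "((\<lambda>t. m x * (trans_prob t x y / t) * ((f x - f y) * (g x - g y)) / 2)
        \<longlongrightarrow> m x * (r * K x y) * ((f x - f y) * (g x - g y)) / 2) (at_right 0)"
    proof (cases "x = y")
      case False
      then have "((\<lambda>t. trans_prob t x y / t) \<longlongrightarrow> r * K x y) (at_right 0)"
        using xy by (intro trans_prob_rate_tendsto) auto
      then show ?thesis
        by (intro tendsto_divide[OF tendsto_mult[OF tendsto_mult[OF tendsto_const] tendsto_const] tendsto_const]) auto
    qed simp
  qed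
  then show "((\<lambda>t. dirichlet_approx M P t f g)
      \<longlongrightarrow> (\<Sum>x\<le>n. \<Sum>y\<le>n. m x * (r * K x y) * ((f x - f y) * (g x - g y)) / 2)) (at_right 0)"
    by (rule Lim_transform_eventually) (auto simp: eventually_at_filter dirichlet_approx_eq)
qed simp

lemma markov_domain_eq: "markov_domain M P = UNIV"
proof -
  have "f \<in> markov_domain M P" for f
  proof -
    have "f \<in> L2 M"
      unfolding L2_def by (auto simp: M_def integrable_point_measure_finite measurable_point_measure_eq1)
    moreover have "bdd_above ((\<lambda>t. dirichlet_approx M P t f f) ` {0<..})"
    proof (rule bdd_aboveI2)
      fix t :: real assume t: "t \<in> {0<..}"
      show "dirichlet_approx M P t f f \<le> (\<Sum>x\<le>n. \<Sum>y\<le>n. m x * r * ((f x - f y) * (f x - f y)) / 2)"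
        unfolding dirichlet_approx_eq[OF t[unfolded greaterThan_iff]]
      proof (intro sum_mono)
        fix x y assume xy: "x \<in> {..n}" "y \<in> {..n}"
        show "m x * (trans_prob t x y / t) * ((f x - f y) * (f x - f y)) / 2
            \<le> m x * r * ((f x - f y) * (f x - f y)) / 2"
        proof (cases "x = y")
          case False
          then have "trans_prob t x y / t \<le> r" using trans_prob_le[of x y t] xy t by (simp add: field_simps)
          then show ?thesis using m_pos[of x] xy
            by (intro divide_right_mono mult_right_mono mult_left_mono) auto
        qed simp
      qed
    qed
    ultimately show ?thesis by (simp add: markov_domain_def)
  qed
  then show ?thesis by auto
qed

lemma Ent_M: "Ent M g = fin_ent m n g"
  by (simp add: Ent_def fin_ent_def integral_M m_sum)

end


text \<open>Any symmetric conductance \<open>c\<close> on \<open>{..n}\<close> can be realized, by uniformizing the jump rates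
  \<open>c x y / m x\<close> with a rate \<open>r\<close> that dominates all exit rates.\<close>

lemma ex_reversible_markov:
  assumes m_pos: "\<And>x. x \<le> n \<Longrightarrow> 0 < m x" and m_sum: "(\<Sum>x\<le>n. m x) = 1"
    and c_nonneg: "\<And>x y. x \<le> n \<Longrightarrow> y \<le> n \<Longrightarrow> 0 \<le> c x y"
    and c_sym: "\<And>x y. x \<le> n \<Longrightarrow> y \<le> n \<Longrightarrow> c x y = c y x"
  obtains M :: "nat measure" and P where "reversible_markov M P" "space M = {..n}" "markov_domain M P = UNIV"
    "\<And>g. Ent M g = fin_ent m n g"
    "\<And>f g. markov_form M P f g = (\<Sum>x\<le>n. \<Sum>y\<le>n. c x y * ((f x - f y) * (g x - g y)) / 2)"
proof -
  \<comment> \<open>The double sum bounds the exit rate of every state at once, and the summand 1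
    keeps \<open>r\<close> positive.\<close>
  define r where "r = 1 + (\<Sum>x\<le>n. \<Sum>y\<le>n. c x y / m x)"
  have r: "1 \<le> r" unfolding r_def using m_pos c_nonneg by (auto intro!: sum_nonneg divide_nonneg_pos)
  define k where "k x y = c x y / (r * m x)" for x y
  \<comment> \<open>The diagonal takes whatever mass the jumps leave; it is nonnegative by the
    choice of \<open>r\<close>.\<close>
  define K where "K x y = (if x = y then 1 - (\<Sum>z\<in>{..n} - {x}. k x z) else k x y)" for x y
  have k0: "0 \<le> k x y" if "x \<le> n" "y \<le> n" for x y
    using that m_pos[of x] c_nonneg[of x y] r by (simp add: k_def)
  have k1: "(\<Sum>z\<in>{..n} - {x}. k x z) \<le> 1" if x: "x \<le> n" for x
  proof -
    have "(\<Sum>z\<in>{..n} - {x}. k x z) \<le> (\<Sum>z\<le>n. k x z)"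
      using x k0 by (intro sum_mono2) auto
    also have "\<dots> = (\<Sum>y\<le>n. c x y / m x) / r" by (simp add: k_def sum_divide_distrib mult.commute)
    also have "(\<Sum>y\<le>n. c x y / m x) \<le> (\<Sum>x\<le>n. \<Sum>y\<le>n. c x y / m x)"
      using x m_pos c_nonneg
      by (intro member_le_sum[where f = "\<lambda>x. \<Sum>y\<le>n. c x y / m x"]) (auto intro!: sum_nonneg divide_nonneg_pos)
    also have "\<dots> / r \<le> 1" using r by (simp add: r_def)
    finally show ?thesis using r by (simp add: divide_right_mono)
  qed
  interpret finite_reversible_kernel n m K r
  proof
    show "0 < m x" if "x \<le> n" for x by (rule m_pos[OF that])
    show "(\<Sum>x\<le>n. m x) = 1" by (rule m_sum)
    show "0 < r" using r by simp
    show "0 \<le> K x y" if "x \<le> n" "y \<le> n" for x y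
      using that k0 k1 by (simp add: K_def)
    show "(\<Sum>y\<le>n. K x y) = 1" if "x \<le> n" for x
    proof -
      have "(\<Sum>y\<le>n. K x y) = K x x + (\<Sum>y\<in>{..n} - {x}. K x y)"
        using that by (intro sum.remove) auto
      also have "(\<Sum>y\<in>{..n} - {x}. K x y) = (\<Sum>y\<in>{..n} - {x}. k x y)"
        by (intro sum.cong) (auto simp: K_def)
      finally show ?thesis by (simp add: K_def)
    qed
    show "m x * K x y = m y * K y x" if "x \<le> n" "y \<le> n" for x y
      using that m_pos[of x] m_pos[of y] r c_sym[of x y] by (simp add: K_def k_def)
  qed
  have *: "m x * (r * K x y) * (d * e) = c x y * (d * e)" if "x \<le> n" "x = y \<longrightarrow> d = 0" for x y d e
    using that m_pos[of x] r by (auto simp: K_def k_def)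
  have form: "markov_form M P f g = (\<Sum>x\<le>n. \<Sum>y\<le>n. c x y * ((f x - f y) * (g x - g y)) / 2)" for f g
    unfolding markov_form_eq
  proof (intro sum.cong refl)
    fix x y assume "x \<in> {..n}"
    then show "m x * (r * K x y) * ((f x - f y) * (g x - g y)) / 2 = c x y * ((f x - f y) * (g x - g y)) / 2"
      by (subst *) auto
  qed
  show thesis by (rule that[of M P]) (rule reversible_markov space_M markov_domain_eq Ent_M form)+
qed

section \<open>Finite birth-death chains and the comparison of exponents\<close>

lemma ex_birth_death_markov:
  assumes m_pos: "\<And>x. x \<le> n \<Longrightarrow> 0 < m x" and m_sum: "(\<Sum>x\<le>n. m x) = 1"
  shows "\<exists>(M :: nat measure) P. reversible_markov M P \<and>
    (\<forall>q C. 0 < q \<longrightarrow> q < 1 \<longrightarrow> markov_LS M P q C = fin_LS m n q (C * q\<^sup>2 / (4 * (1 - q))))"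
proof -
  \<comment> \<open>Each bond carries the weight of its left endpoint, as in the birth-death form.
    It is entered in both orders, which the factor 1/2 in the form compensates.\<close>
  define c where "c x y = (if y = Suc x then m x else 0) + (if x = Suc y then m y else 0)" for x y
  have c: "\<And>x y. x \<le> n \<Longrightarrow> y \<le> n \<Longrightarrow> 0 \<le> c x y" "\<And>x y. x \<le> n \<Longrightarrow> y \<le> n \<Longrightarrow> c x y = c y x"
    using m_pos by (auto simp: c_def less_imp_le)
  obtain M :: "nat measure" and P where MP: "reversible_markov M P" "space M = {..n}"
    "markov_domain M P = UNIV" "\<And>g. Ent M g = fin_ent m n g"
    "\<And>f g. markov_form M P f g = (\<Sum>x\<le>n. \<Sum>y\<le>n. c x y * ((f x - f y) * (g x - g y)) / 2)"
    by (rule ex_reversible_markov[where n = n and m = m and c = c, OF _ _ _ _ that]) (use m_pos m_sum c in auto)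
  have form: "markov_form M P f g = (\<Sum>x<n. m x * ((f (Suc x) - f x) * (g (Suc x) - g x)))" for f g
  proof -
    define F where "F x y = (if y = Suc x then m x * ((f (Suc x) - f x) * (g (Suc x) - g x)) / 2 else 0)" for x y
    have "markov_form M P f g = (\<Sum>x\<le>n. \<Sum>y\<le>n. F x y + F y x)"
      unfolding MP(5) by (intro sum.cong) (auto simp: c_def F_def field_simps)
    also have "\<dots> = (\<Sum>x\<le>n. \<Sum>y\<le>n. F x y) + (\<Sum>x\<le>n. \<Sum>y\<le>n. F y x)"
      by (simp add: sum.distrib)
    also have "(\<Sum>x\<le>n. \<Sum>y\<le>n. F y x) = (\<Sum>x\<le>n. \<Sum>y\<le>n. F x y)" by (rule sum.swap)
    also have "(\<Sum>x\<le>n. \<Sum>y\<le>n. F x y)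
        = (\<Sum>x\<le>n. if Suc x \<le> n then m x * ((f (Suc x) - f x) * (g (Suc x) - g x)) / 2 else 0)"
      by (simp add: F_def)
    also have "\<dots> = (\<Sum>x<n. m x * ((f (Suc x) - f x) * (g (Suc x) - g x)) / 2)"
      by (intro sum.mono_neutral_cong_right) auto
    finally show ?thesis by (simp add: sum.distrib[symmetric])
  qed
  have "markov_LS M P q C = fin_LS m n q (C * q\<^sup>2 / (4 * (1 - q)))" if q: "0 < q" "q < 1" for q C
  proof -
    have "C * q\<^sup>2 / (4 * (q - 1)) * markov_form M P (\<lambda>x. f x powr (q - 1)) f
        = C * q\<^sup>2 / (4 * (1 - q)) * fin_energy m n q f" for f
    proof -
      have "markov_form M P (\<lambda>x. f x powr (q - 1)) f = - fin_energy m n q f"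
        unfolding form fin_energy_def bd_energy_def sum_negf[symmetric]
        by (intro sum.cong) (auto simp: algebra_simps)
      moreover have "C * q\<^sup>2 / (4 * (q - 1)) = - (C * q\<^sup>2 / (4 * (1 - q)))"
        using q by (simp add: field_simps)
      ultimately show ?thesis by simp
    qed
    moreover have "(\<forall>x\<in>{..n}. 0 < f x) \<and> (\<forall>x\<in>{..n}. 0 < f x powr (q - 1)) \<longleftrightarrow> (\<forall>x\<le>n. 0 < f x)"
      for f :: "nat \<Rightarrow> real"
      by force
    moreover have "markov_LS M P q C \<longleftrightarrow>
        (\<forall>f. (\<forall>x\<in>{..n}. 0 < f x) \<and> (\<forall>x\<in>{..n}. 0 < f x powr (q - 1)) \<longrightarrow> fin_ent m n (\<lambda>x. f x powr q)
          \<le> C * q\<^sup>2 / (4 * (q - 1)) * markov_form M P (\<lambda>x. f x powr (q - 1)) f)"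
      using q unfolding log_sobolev_def positive_members_def MP(2-4) by auto
    ultimately show ?thesis by (simp only: fin_LS_def)
  qed
  with MP(1) show ?thesis by blast
qed

text \<open>The order of choices matters: the \<open>q\<close>-constant \<open>C\<close> serves all
  initial segments, so it is fixed first, and only then is \<open>n\<close> taken so large that the
  \<open>p\<close>-inequality with constant \<open>c * C\<close> fails.\<close>

lemma no_uniform_comparison:
  fixes q p c :: real
  assumes q: "0 < q" "q < p" "p < 1" and c: "0 < c"
  shows "\<exists>C>0. \<exists>(M :: nat measure) P. reversible_markov M P \<and> markov_LS M P q C \<and> \<not> markov_LS M P p (c * C)"
proof -
  obtain K where K: "0 < K" "\<And>n. fin_LS (wt p) n q K"
    using fin_LS_below_exponent[OF q] by auto
  define C where "C = 4 * (1 - q) / q\<^sup>2 * K"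
  have C: "0 < C" "C * q\<^sup>2 / (4 * (1 - q)) = K" using q K by (auto simp: C_def)
  obtain n where n: "\<not> fin_LS (wt p) n p (c * C * p\<^sup>2 / (4 * (1 - p)))"
    using not_fin_LS_at_exponent q by (meson less_trans)
  define Z where "Z = (\<Sum>k\<le>n. wt p k)"
  have Z: "0 < Z" unfolding Z_def by (intro sum_pos wt_pos) auto
  define m where "m = (\<lambda>k. 1 / Z * wt p k)"
  have fin: "fin_LS m n s L = fin_LS (wt p) n s L" for s L
    unfolding m_def using Z by (intro fin_LS_scale_weight) auto
  have m_pos: "0 < m x" for x using Z wt_pos[of p x] by (simp add: m_def)
  have m_sum: "(\<Sum>x\<le>n. m x) = 1"
    using Z unfolding m_def sum_distrib_left[symmetric] Z_def[symmetric] by simp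
  obtain M :: "nat measure" and P where MP: "reversible_markov M P"
    "\<forall>s C. 0 < s \<longrightarrow> s < 1 \<longrightarrow> markov_LS M P s C = fin_LS m n s (C * s\<^sup>2 / (4 * (1 - s)))"
    using ex_birth_death_markov[OF m_pos m_sum] by (elim exE conjE) (rule that)
  have "markov_LS M P q C" using q K C by (simp add: MP fin)
  moreover have "\<not> markov_LS M P p (c * C)" using q n by (simp add: MP fin)
  ultimately show ?thesis
    using C(1) MP(1) by (intro exI[of _ C] conjI exI[of _ M] exI[of _ P])
qed

theorem theorem2p2:
  "(\<forall>p::real. 0 < p \<and> p < 1 \<longrightarrow>
      (\<exists>M :: nat measure. discrete_prob_space M \<and> space M = UNIV \<and>
         \<not> (\<exists>C>0. birth_death_LS M p C) \<and>
         (\<forall>q. 0 < q \<and> q < p \<longrightarrow> (\<exists>C>0. birth_death_LS M q C))))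
   \<and>
   \<not> (\<exists>I :: real set. is_interval I \<and> I \<subseteq> {0<..1} \<and> interior I \<noteq> {} \<and>
        (\<exists>c>0. \<forall>p\<in>I. \<forall>q\<in>I. \<forall>C>0. \<forall>(M :: nat measure) P.
           reversible_markov M P \<longrightarrow> markov_LS M P p C \<longrightarrow> markov_LS M P q (c * C)))"
proof (intro conjI allI impI notI)
  fix p :: real assume "0 < p \<and> p < 1"
  then show "\<exists>M :: nat measure. discrete_prob_space M \<and> space M = UNIV \<and>
         \<not> (\<exists>C>0. birth_death_LS M p C) \<and>
         (\<forall>q. 0 < q \<and> q < p \<longrightarrow> (\<exists>C>0. birth_death_LS M q C))"
    using birth_death_counterexample by blast
next
  assume "\<exists>I :: real set. is_interval I \<and> I \<subseteq> {0<..1} \<and> interior I \<noteq> {} \<and>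
        (\<exists>c>0. \<forall>p\<in>I. \<forall>q\<in>I. \<forall>C>0. \<forall>(M :: nat measure) P.
           reversible_markov M P \<longrightarrow> markov_LS M P p C \<longrightarrow> markov_LS M P q (c * C))"
  then obtain I :: "real set" and c where I: "I \<subseteq> {0<..1}" "interior I \<noteq> {}" and c: "0 < c"
    and uniform: "\<And>p q C (M :: nat measure) P. \<lbrakk>p \<in> I; q \<in> I; 0 < C; reversible_markov M P;
      markov_LS M P p C\<rbrakk> \<Longrightarrow> markov_LS M P q (c * C)"
    by blast
  \<comment> \<open>The interior point \<open>p\<close> serves as the larger exponent and
    \<open>p - e / 2\<close> as the smaller one. That \<open>p + e / 2\<close> also lies in
    \<open>I\<close> gives \<open>p < 1\<close>.\<close>
  obtain p e where e: "0 < e" "ball p e \<subseteq> I" using I by (auto simp: mem_interior)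
  then have "p - e / 2 \<in> I" "p \<in> I" "p + e / 2 \<in> I" by (auto simp: dist_real_def intro!: subsetD[OF e(2)])
  moreover from this have "p + e / 2 \<le> 1" "0 < p - e / 2"
    using subsetD[OF I(1)] by (meson greaterThanAtMost_iff)+
  ultimately have "p - e / 2 \<in> I" "p \<in> I" "0 < p - e / 2" "p < 1" using e by auto
  with no_uniform_comparison[of "p - e / 2" p c] e c obtain C and M :: "nat measure" and P
    where "0 < C" "reversible_markov M P" "markov_LS M P (p - e / 2) C" "\<not> markov_LS M P p (c * C)"
    by auto
  moreover from this have "markov_LS M P p (c * C)"
    using \<open>p - e / 2 \<in> I\<close> \<open>p \<in> I\<close> by (intro uniform[of "p - e / 2"])
  ultimately show False by simp
qed

end
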